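(* Let $(M,g)$ be a smooth $n$-dimensional pseudo-Riemannian manifold (of arbitrary signature), considered locally (connected), and let $H(x,p)=\tfrac12 g^{ij}p_ip_j$ be the Hamiltonian of its geodesic flow on $T^*M$. Suppose there are functions $\overset{1}{I}=2H,\ \overset{2}{I},\dots,\overset{n}{I}$ on $T^*M$, each an integral of the geodesic flow (i.e. $\{H,\overset{\alpha}{I}\}=0$ for the canonical Poisson bracket), satisfying: (1) each integral is quadratic in momenta, $\overset{\alpha}{I}(x,p)=\overset{\alpha}{K}{}^{ij}(x)p_ip_j$ with $\overset{\alpha}{K}{}^{ij}$ a smooth symmetric $(2,0)$-tensor field (so $\overset{1}{K}{}^{ij}=g^{ij}$); (2) at almost every point $x\in M$ there is a basis of $T_xM$ in which all matrices $\big(\overset{\alpha}{K}{}^{ij}(x)\big)$, $\alpha=1,\dots,n$, are simultaneously diagonal; (3) the differentials $d\overset{1}{I},\dots,d\overset{n}{I}$ are linearly independent at at least one point of $T^*M$. Then for almost every point $x\in M$ the restrictions of the tensors $\overset{1}{K}{}^{ij},\dots,\overset{n}{K}{}^{ij}$ to $T_xM$ are linearly independent. In particular, for a generic choice of constants $\lambda_2,\dots,\lambda_n$, the $(1,1)$-tensor field $K^i_j:=K^{si}g_{sj}$, where $K^{ij}=\sum_{\alpha=2}^n\lambda_\alpha\overset{\alpha}{K}{}^{ij}$, has $n$ distinct eigenvalues at almost every point.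
   Context: Indices are raised/lowered with $g$; summation over repeated indices. "Almost every point" means outside a set of measure zero. *)

theory Defs
  imports "HOL-Analysis.Analysis"
begin

text \<open>Local setting: the manifold is an open connected set U of coordinates in R^n
  (points x :: real^'n), the cotangent bundle is U \<times> R^n with points (x,p).\<close>

definition smooth_on :: "(real^'n) set \<Rightarrow> (real^'n \<Rightarrow> real) \<Rightarrow> bool" where
  "smooth_on S f \<longleftrightarrow>
     (\<exists>F. f \<in> F \<and> (\<forall>h\<in>F. \<forall>x\<in>S. h differentiable (at x)) \<and>
          (\<forall>h\<in>F. \<forall>i. \<exists>h'\<in>F. \<forall>x\<in>S. h' x = frechet_derivative h (at x) (axis i 1)))"

definition smooth_matrix_field :: "(real^'n) set \<Rightarrow> (real^'n \<Rightarrow> real^'n^'n) \<Rightarrow> bool" where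
  "smooth_matrix_field S A \<longleftrightarrow> (\<forall>i j. smooth_on S (\<lambda>x. A x $ i $ j))"

definition symmetric_matrix :: "real^'n^'n \<Rightarrow> bool" where
  "symmetric_matrix A \<longleftrightarrow> transpose A = A"

definition diagonal_matrix :: "real^'n^'n \<Rightarrow> bool" where
  "diagonal_matrix A \<longleftrightarrow> (\<forall>i j. i \<noteq> j \<longrightarrow> A $ i $ j = 0)"

definition quad_fun :: "(real^'n \<Rightarrow> real^'n^'n) \<Rightarrow> (real^'n) \<times> (real^'n) \<Rightarrow> real" where
  "quad_fun K z = snd z \<bullet> (K (fst z) *v snd z)"

definition poisson ::
  "((real^'n) \<times> (real^'n) \<Rightarrow> real) \<Rightarrow> ((real^'n) \<times> (real^'n) \<Rightarrow> real) \<Rightarrow> (real^'n) \<times> (real^'n) \<Rightarrow> real" where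
  "poisson F G z = (\<Sum>i\<in>UNIV.
      frechet_derivative F (at z) (0, axis i 1) * frechet_derivative G (at z) (axis i 1, 0)
    - frechet_derivative F (at z) (axis i 1, 0) * frechet_derivative G (at z) (0, axis i 1))"

definition eigenvalues :: "real^'n^'n \<Rightarrow> real set" where
  "eigenvalues A = {\<mu>. \<exists>v. v \<noteq> 0 \<and> A *v v = \<mu> *\<^sub>R v}"

end

(* If the tensors are dependent on a set of positive measure, then on a subset E of positive measure
   some K_b is a combination sum f_a K_a of independent K_a with smooth coefficients f_a. A smooth
   function vanishing on E vanishes to every order at almost every point of E. Hence there the
   Poisson bracket with H gives sum_a {H, f_a} I_a = 0, and reading this cubic in a common
   diagonalizing frame shows df_a = 0. Since also the df_a vanish to higher order almost everywhere
   on E, at some point x0 of E the Killing tensor K_b - sum f_a(x0) K_a, with constant coefficients,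
   has vanishing 2-jet. The Killing equation determines the third derivatives of a Killing
   2-tensor from its 2-jet, so this tensor vanishes identically, contradicting the functional
   independence of the integrals.

   At a point where the K_a are independent and simultaneously diagonal, the constants for which two
   eigenvalues coincide fill finitely many hyperplanes; Fubini's theorem exchanges the order of the two
   almost-everywhere quantifiers. *)
theory Submission
  imports Defs
begin

subsection \<open>Partial derivatives and smooth functions\<close>

text \<open>The dependent set has no interior in general, so a relation that holds on it cannot be
  differentiated there. Its coefficients are therefore replaced by Cramer quotients of a Gram
  matrix, which are defined on an open neighbourhood; off the set the relation then fails by a
  smooth error that vanishes on the set. The set itself may be arbitrary: each of its points is
  shown to lie in an explicit null set, where some error term or some gradient component vanishes
  without being flat.

  For the Killing equation no connection is written down. Its prolongation is kept as an inequality,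
  bounding the derivatives of the 2-jet by the 2-jet itself, and this already forces uniqueness by a
  Gronwall-type estimate.

  For the eigenvalues, the exchange of quantifiers requires a Borel set of bad pairs in the product.
  The number of eigenvalues does not exhibit one directly; two orthonormal eigenvectors for one
  eigenvalue do, since this is a closed condition on unit vectors.\<close>

definition pd :: "'n::finite \<Rightarrow> (real^'n \<Rightarrow> real) \<Rightarrow> real^'n \<Rightarrow> real" where
  "pd i f x = frechet_derivative f (at x) (axis i 1)"

lemma pd_has_derivative: "(f has_derivative f') (at x) \<Longrightarrow> pd i f x = f' (axis i 1)"
  by (simp add: pd_def frechet_derivative_at[symmetric])

lemma has_derivative_cong_open:
  assumes "open S" "x \<in> S" "\<And>y. y \<in> S \<Longrightarrow> f y = h y"
  shows "(f has_derivative f') (at x) \<longleftrightarrow> (h has_derivative f') (at x)"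
  using assms by (metis has_derivative_transform_within_open)

lemma frechet_derivative_cong_open:
  assumes "open S" "x \<in> S" "\<And>y. y \<in> S \<Longrightarrow> f y = h y"
  shows "frechet_derivative f (at x) = frechet_derivative h (at x)"
  unfolding frechet_derivative_def using has_derivative_cong_open[OF assms] by simp

lemma pd_cong:
  assumes "open S" "x \<in> S" "\<And>y. y \<in> S \<Longrightarrow> f y = h y"
  shows "pd i f x = pd i h x"
  unfolding pd_def using frechet_derivative_cong_open[OF assms] by simp

lemma frechet_derivative_pd:
  assumes "f differentiable (at x)"
  shows "frechet_derivative f (at x) v = (\<Sum>i\<in>UNIV. v $ i * pd i f x)"
proof -
  interpret linear "frechet_derivative f (at x)"
    using assms linear_frechet_derivative by blast
  have "frechet_derivative f (at x) v = frechet_derivative f (at x) (\<Sum>i\<in>UNIV. v $ i *\<^sub>R axis i 1)"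
    using basis_expansion[of v] by (simp add: scalar_mult_eq_scaleR)
  then show ?thesis
    by (simp add: sum scale pd_def)
qed

lemma has_derivative_pd:
  assumes "f differentiable (at x)"
  shows "(f has_derivative (\<lambda>v. \<Sum>i\<in>UNIV. v $ i * pd i f x)) (at x)"
proof -
  have "frechet_derivative f (at x) = (\<lambda>v. \<Sum>i\<in>UNIV. v $ i * pd i f x)"
    using frechet_derivative_pd[OF assms] by blast
  then show ?thesis
    using assms frechet_derivative_works by metis
qed

lemma pd_const [simp]: "pd i (\<lambda>x. c) x = 0"
  by (simp add: pd_def)

lemma pd_add:
  assumes "f differentiable (at x)" "h differentiable (at x)"
  shows "pd i (\<lambda>y. f y + h y) x = pd i f x + pd i h x"
  using pd_has_derivative[OF has_derivative_add[OF assms[THEN has_derivative_pd]]]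
    assms by (simp add: pd_has_derivative[OF has_derivative_pd, symmetric])

lemma pd_mult:
  assumes "f differentiable (at x)" "h differentiable (at x)"
  shows "pd i (\<lambda>y. f y * h y) x = f x * pd i h x + pd i f x * h x"
  using pd_has_derivative[OF has_derivative_mult[OF assms[THEN has_derivative_pd]]]
    assms by (simp add: pd_has_derivative[OF has_derivative_pd, symmetric])

lemma pd_cmult:
  assumes "f differentiable (at x)"
  shows "pd i (\<lambda>y. c * f y) x = c * pd i f x"
  using pd_mult[OF _ assms, of "\<lambda>_. c"] by simp

lemma pd_diff:
  assumes "f differentiable (at x)" "h differentiable (at x)"
  shows "pd i (\<lambda>y. f y - h y) x = pd i f x - pd i h x"
  using pd_add[OF assms(1), of "\<lambda>y. (-1) * h y" i] pd_cmult[OF assms(2), of i "-1"] assms(2)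
  by simp

lemma differentiable_sum:
  assumes "\<And>a. a \<in> A \<Longrightarrow> f a differentiable (at x)"
  shows "(\<lambda>y. \<Sum>a\<in>A. f a y :: real) differentiable (at x)"
  using assms by (induction A rule: infinite_finite_induct) auto

lemma pd_sum:
  assumes "\<And>a. a \<in> A \<Longrightarrow> f a differentiable (at x)"
  shows "pd i (\<lambda>y. \<Sum>a\<in>A. f a y) x = (\<Sum>a\<in>A. pd i (f a) x)"
  using assms
proof (induction A rule: infinite_finite_induct)
  case (insert a A)
  then show ?case
    by (simp add: pd_add differentiable_sum)
qed auto

lemma pd_inverse:
  assumes "f differentiable (at x)" "f x \<noteq> 0"
  shows "pd i (\<lambda>y. inverse (f y)) x = - (pd i f x * (inverse (f x) * inverse (f x)))"
  using pd_has_derivative[OF Deriv.has_derivative_inverse[OF assms(2) has_derivative_pd[OF assms(1)]], of i]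
    assms by (simp add: pd_has_derivative[OF has_derivative_pd, symmetric])

text \<open>\<open>smooth_on\<close> asks for a class of functions closed under partial derivatives,
  and for products or quotients such a class would have to be exhibited. Counting derivatives
  permits induction instead. Order \<open>n\<close> means \<open>n\<close> times differentiable,
  without continuity of the last derivatives; this makes no difference once all orders are
  required.\<close>

primrec Ck :: "(real^'n::finite) set \<Rightarrow> nat \<Rightarrow> (real^'n \<Rightarrow> real) \<Rightarrow> bool" where
  "Ck S 0 f \<longleftrightarrow> True"
| "Ck S (Suc n) f \<longleftrightarrow> (\<forall>x\<in>S. f differentiable (at x)) \<and> (\<forall>i. Ck S n (pd i f))"

lemma Ck_cong:
  assumes "open S" "\<And>y. y \<in> S \<Longrightarrow> f y = h y" "Ck S n f"
  shows "Ck S n h"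
  using assms(2,3)
proof (induction n arbitrary: f h)
  case (Suc n)
  have "h differentiable (at x)" if "x \<in> S" for x
    using Suc.prems that has_derivative_cong_open[OF assms(1) that, of f h]
    by (metis Ck.simps(2) differentiable_def)
  moreover have "Ck S n (pd i h)" for i
    by (rule Suc.IH[of "pd i f"]) (use Suc.prems in \<open>auto intro: pd_cong[OF assms(1)]\<close>)
  ultimately show ?case by simp
qed simp

lemma Ck_Suc_D: "Ck S (Suc n) f \<Longrightarrow> Ck S n f"
  by (induction n arbitrary: f) auto

lemma smooth_on_iff_Ck:
  assumes "open S"
  shows "smooth_on S f \<longleftrightarrow> (\<forall>n. Ck S n f)"
proof
  assume "smooth_on S f"
  then obtain F where F: "f \<in> F" "\<And>h x. h \<in> F \<Longrightarrow> x \<in> S \<Longrightarrow> h differentiable (at x)"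
    "\<And>h i. h \<in> F \<Longrightarrow> \<exists>h'\<in>F. \<forall>x\<in>S. h' x = pd i h x"
    unfolding smooth_on_def pd_def by metis
  have "Ck S n h" if "h \<in> F" for n h
    using that
  proof (induction n arbitrary: h)
    case (Suc n)
    have "Ck S n (pd i h)" for i
    proof -
      obtain h' where "h' \<in> F" "\<forall>x\<in>S. h' x = pd i h x"
        using F(3) Suc.prems by blast
      then show ?thesis
        using Ck_cong[OF assms] Suc.IH by blast
    qed
    then show ?case
      using F(2) Suc.prems by simp
  qed simp
  then show "\<forall>n. Ck S n f"
    using F(1) by blast
next
  assume *: "\<forall>n. Ck S n f"
  \<comment> \<open>The largest candidate for the witness: it is closed under \<open>pd i\<close>
    because a derivative costs just one order.\<close>
  let ?F = "{f. \<forall>n. Ck S n f}"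
  have "h differentiable (at x)" if "h \<in> ?F" "x \<in> S" for h x
    using that Ck.simps(2)[of S 0 h] by blast
  moreover have "pd i h \<in> ?F" if "h \<in> ?F" for h i
    using that Ck.simps(2) by blast
  moreover have "f \<in> ?F"
    using * by simp
  ultimately show "smooth_on S f"
    unfolding smooth_on_def pd_def[symmetric]
    by (intro exI[of _ ?F] conjI ballI allI bexI[of _ "pd _ _"]) auto
qed

lemma smooth_on_differentiable: "smooth_on S f \<Longrightarrow> x \<in> S \<Longrightarrow> f differentiable (at x)"
  unfolding smooth_on_def by blast

lemma smooth_on_pd:
  assumes "open S" "smooth_on S f"
  shows "smooth_on S (pd i f)"
  using assms Ck.simps(2) unfolding smooth_on_iff_Ck[OF assms(1)] by blast

lemma smooth_on_continuous_on:
  assumes "smooth_on S f"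
  shows "continuous_on S f"
  using smooth_on_differentiable[OF assms]
  by (meson continuous_at_imp_continuous_on differentiable_imp_continuous_within)

lemma smooth_on_subset: "smooth_on T f \<Longrightarrow> S \<subseteq> T \<Longrightarrow> smooth_on S f"
  unfolding smooth_on_def by (metis subsetD)

lemma Ck_const: "Ck S n (\<lambda>x. c)"
proof (induction n arbitrary: c)
  case (Suc n)
  have "pd i (\<lambda>x. c) = (\<lambda>x. 0)" for i :: 'a
    by (rule ext) simp
  then show ?case
    using Suc by simp
qed simp

lemma Ck_add:
  assumes "open S" "Ck S n f" "Ck S n h"
  shows "Ck S n (\<lambda>x. f x + h x)"
  using assms(2,3)
proof (induction n arbitrary: f h)
  case (Suc n)
  have "Ck S n (pd i (\<lambda>x. f x + h x))" for i
    by (rule Ck_cong[OF assms(1) _ Suc.IH[of "pd i f" "pd i h"]]) (use Suc.prems in \<open>auto simp: pd_add\<close>)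
  then show ?case
    using Suc.prems by auto
qed simp

lemma Ck_mult:
  assumes "open S" "Ck S n f" "Ck S n h"
  shows "Ck S n (\<lambda>x. f x * h x)"
  using assms(2,3)
proof (induction n arbitrary: f h)
  case (Suc n)
  have "Ck S n (\<lambda>x. f x * pd i h x + pd i f x * h x)" for i
    by (intro Ck_add[OF assms(1)] Suc.IH) (use Suc.prems Ck_Suc_D[OF Suc.prems(1)] Ck_Suc_D[OF Suc.prems(2)] in simp_all)
  then have "Ck S n (pd i (\<lambda>x. f x * h x))" for i
    by (rule Ck_cong[OF assms(1), rotated]) (use Suc.prems in \<open>auto simp: pd_mult\<close>)
  then show ?case
    using Suc.prems by auto
qed simp

text \<open>The derivative of 1/f is, up to sign, a derivative of f times two copies of 1/f, so the
  induction on the order runs for one fixed f.\<close>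

lemma Ck_inverse:
  assumes "open S" "Ck S n f" "\<And>x. x \<in> S \<Longrightarrow> f x \<noteq> 0"
  shows "Ck S n (\<lambda>x. inverse (f x))"
  using assms(2)
proof (induction n)
  case (Suc n)
  have "Ck S n (\<lambda>x. (-1) * (pd i f x * (inverse (f x) * inverse (f x))))" for i
    by (intro Ck_mult[OF assms(1)] Ck_const Suc.IH) (use Suc.prems Ck_Suc_D[OF Suc.prems(1)] in simp_all)
  then have "Ck S n (pd i (\<lambda>x. inverse (f x)))" for i
    by (rule Ck_cong[OF assms(1), rotated]) (use Suc.prems assms(3) in \<open>simp add: pd_inverse\<close>)
  moreover have "(\<lambda>x. inverse (f x)) differentiable (at x)" if "x \<in> S" for x
    using Suc.prems assms(3) that by (intro differentiable_inverse) simp_all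
  ultimately show ?case
    by simp
qed simp

lemma smooth_on_const: "open S \<Longrightarrow> smooth_on S (\<lambda>x. c)"
  by (simp add: smooth_on_iff_Ck Ck_const)

lemma smooth_on_add:
  "open S \<Longrightarrow> smooth_on S f \<Longrightarrow> smooth_on S h \<Longrightarrow> smooth_on S (\<lambda>x. f x + h x)"
  by (simp add: smooth_on_iff_Ck Ck_add)

lemma smooth_on_mult:
  "open S \<Longrightarrow> smooth_on S f \<Longrightarrow> smooth_on S h \<Longrightarrow> smooth_on S (\<lambda>x. f x * h x)"
  by (simp add: smooth_on_iff_Ck Ck_mult)

lemma smooth_on_diff:
  "open S \<Longrightarrow> smooth_on S f \<Longrightarrow> smooth_on S h \<Longrightarrow> smooth_on S (\<lambda>x. f x - h x)"
  using smooth_on_add[of S f "\<lambda>x. (-1) * h x"] smooth_on_mult[of S "\<lambda>x. -1" h]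
    smooth_on_const[of S "-1"] by simp

lemma smooth_on_divide:
  "open S \<Longrightarrow> smooth_on S f \<Longrightarrow> smooth_on S h \<Longrightarrow> (\<And>x. x \<in> S \<Longrightarrow> h x \<noteq> 0) \<Longrightarrow>
    smooth_on S (\<lambda>x. f x / h x)"
  by (simp add: smooth_on_iff_Ck Ck_mult Ck_inverse divide_inverse)

lemma smooth_on_sum:
  "open S \<Longrightarrow> (\<And>a. a \<in> A \<Longrightarrow> smooth_on S (f a)) \<Longrightarrow> smooth_on S (\<lambda>x. \<Sum>a\<in>A. f a x)"
  by (induction A rule: infinite_finite_induct) (auto intro: smooth_on_add smooth_on_const)

lemma smooth_on_prod:
  "open S \<Longrightarrow> (\<And>a. a \<in> A \<Longrightarrow> smooth_on S (f a)) \<Longrightarrow> smooth_on S (\<lambda>x. \<Prod>a\<in>A. f a x)"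
  by (induction A rule: infinite_finite_induct) (auto intro: smooth_on_mult smooth_on_const)

lemma smooth_on_det:
  fixes A :: "real^'n::finite \<Rightarrow> real^'m::finite^'m"
  assumes "open S" "\<And>i j. smooth_on S (\<lambda>x. A x $ i $ j)"
  shows "smooth_on S (\<lambda>x. det (A x))"
  unfolding det_def
  by (intro smooth_on_sum smooth_on_mult smooth_on_const smooth_on_prod assms)

section \<open>Symmetry of second partial derivatives\<close>

lemma pd_along_line:
  assumes "f differentiable (at (y + t *\<^sub>R axis i 1))"
  shows "((\<lambda>s. f (y + s *\<^sub>R axis i 1)) has_real_derivative pd i f (y + t *\<^sub>R axis i 1)) (at t)"
proof -
  have "((\<lambda>s. y + s *\<^sub>R axis i 1) has_derivative (\<lambda>s. s *\<^sub>R axis i 1)) (at t)"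
    by (auto intro!: derivative_eq_intros)
  from has_derivative_compose[OF this has_derivative_pd[OF assms]]
  have "((\<lambda>s. f (y + s *\<^sub>R axis i 1)) has_derivative
      (\<lambda>s. \<Sum>k\<in>UNIV. (s *\<^sub>R axis i 1 :: real^'a) $ k * pd k f (y + t *\<^sub>R axis i 1))) (at t)" .
  moreover have "(\<Sum>k\<in>UNIV. (s *\<^sub>R axis i 1 :: real^'a) $ k * pd k f (y + t *\<^sub>R axis i 1)) =
      pd i f (y + t *\<^sub>R axis i 1) * s" for s
    by (simp add: axis_def if_distrib[where f = "\<lambda>c. _ * c"] if_distrib[where f = "\<lambda>c. c * _"]
        mult.commute cong: if_cong)
  ultimately show ?thesis
    by (simp add: has_field_derivative_def)
qed

text \<open>The mean value theorem is applied twice: to the increment of \<open>f\<close> in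
  direction \<open>j\<close> as a function of the \<open>i\<close>-coordinate, then to
  \<open>pd i f\<close> along direction \<open>j\<close>. The left side is symmetric in
  \<open>i\<close> and \<open>j\<close>, the right side is not visibly so.\<close>

lemma second_difference_mean_value:
  assumes "0 < h"
    and f: "\<And>s t. 0 \<le> s \<Longrightarrow> s \<le> h \<Longrightarrow> 0 \<le> t \<Longrightarrow> t \<le> h \<Longrightarrow>
       f differentiable (at (x + s *\<^sub>R axis i 1 + t *\<^sub>R axis j 1)) \<and>
       pd i f differentiable (at (x + s *\<^sub>R axis i 1 + t *\<^sub>R axis j 1))"
  shows "\<exists>s t. 0 < s \<and> s < h \<and> 0 < t \<and> t < h \<and>
    f (x + h *\<^sub>R axis i 1 + h *\<^sub>R axis j 1) - f (x + h *\<^sub>R axis i 1) - f (x + h *\<^sub>R axis j 1) + f x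
     = h * h * pd j (pd i f) (x + s *\<^sub>R axis i 1 + t *\<^sub>R axis j 1)"
proof -
  let ?g = "\<lambda>s. f (x + s *\<^sub>R axis i 1 + h *\<^sub>R axis j 1) - f (x + s *\<^sub>R axis i 1)"
  have "(?g has_real_derivative (pd i f (x + s *\<^sub>R axis i 1 + h *\<^sub>R axis j 1) - pd i f (x + s *\<^sub>R axis i 1))) (at s)"
    if "0 \<le> s" "s \<le> h" for s
  proof (rule DERIV_diff)
    show "((\<lambda>s. f (x + s *\<^sub>R axis i 1 + h *\<^sub>R axis j 1)) has_real_derivative
        pd i f (x + s *\<^sub>R axis i 1 + h *\<^sub>R axis j 1)) (at s)"
      using pd_along_line[of f "x + h *\<^sub>R axis j 1" s i] f[OF that, of h] assms(1)
      by (simp add: add_ac)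
    show "((\<lambda>s. f (x + s *\<^sub>R axis i 1)) has_real_derivative pd i f (x + s *\<^sub>R axis i 1)) (at s)"
      using pd_along_line[of f x s i] f[OF that, of 0] assms(1) by simp
  qed
  from MVT2[OF assms(1) this] obtain s where s: "0 < s" "s < h"
    "?g h - ?g 0 = h * (pd i f (x + s *\<^sub>R axis i 1 + h *\<^sub>R axis j 1) - pd i f (x + s *\<^sub>R axis i 1))"
    by auto
  have "((\<lambda>t. pd i f (x + s *\<^sub>R axis i 1 + t *\<^sub>R axis j 1)) has_real_derivative
      pd j (pd i f) (x + s *\<^sub>R axis i 1 + t *\<^sub>R axis j 1)) (at t)" if "0 \<le> t" "t \<le> h" for t
    using pd_along_line[of "pd i f" "x + s *\<^sub>R axis i 1" t j] f[of s t] s that by simp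
  from MVT2[OF assms(1) this] obtain t where t: "0 < t" "t < h"
    "pd i f (x + s *\<^sub>R axis i 1 + h *\<^sub>R axis j 1) - pd i f (x + s *\<^sub>R axis i 1)
      = h * pd j (pd i f) (x + s *\<^sub>R axis i 1 + t *\<^sub>R axis j 1)"
    by auto
  show ?thesis
    using s t by (intro exI[of _ s] exI[of _ t]) simp
qed

text \<open>Both iterated derivatives are limits of the same second difference quotient.\<close>

lemma pd_commute:
  assumes "open S" "smooth_on S f" "x \<in> S"
  shows "pd i (pd j f) x = pd j (pd i f) x"
proof (rule ccontr)
  define a where "a = pd j (pd i f)"
  define b where "b = pd i (pd j f)"
  assume "pd i (pd j f) x \<noteq> pd j (pd i f) x"
  then have ne: "\<bar>a x - b x\<bar> / 2 > 0"
    by (simp add: a_def b_def)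
  have sm: "smooth_on S (pd i f)" "smooth_on S (pd j f)" "smooth_on S a" "smooth_on S b"
    using assms smooth_on_pd a_def b_def by metis+
  have "isCont a x" "isCont b x"
    using sm(3,4) assms(1,3) smooth_on_continuous_on continuous_on_eq_continuous_at by blast+
  then obtain d1 d2 where d: "d1 > 0" "\<And>y. dist y x < d1 \<Longrightarrow> dist (a y) (a x) < \<bar>a x - b x\<bar> / 2"
      "d2 > 0" "\<And>y. dist y x < d2 \<Longrightarrow> dist (b y) (b x) < \<bar>a x - b x\<bar> / 2"
    using ne unfolding continuous_at_eps_delta by metis
  obtain e where e: "e > 0" "ball x e \<subseteq> S"
    using assms openE by blast
  define r where "r = Min {d1, d2, e}"
  have r: "r > 0" "r \<le> d1" "r \<le> d2" "r \<le> e"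
    using d e by (auto simp: r_def)
  \<comment> \<open>Points of the square are reached by two axis steps of length at most
    \<open>h\<close>, hence by a displacement of at most 2r/3.\<close>
  define h where "h = r / 3"
  have h: "h > 0"
    using r by (simp add: h_def)
  have near: "dist (x + s *\<^sub>R axis k 1 + t *\<^sub>R axis l 1) x < r"
    if "0 \<le> s" "s \<le> h" "0 \<le> t" "t \<le> h" for s t k l
  proof -
    have "norm (s *\<^sub>R axis k (1::real) + t *\<^sub>R axis l 1) \<le> s + t"
      using norm_triangle_ineq[of "s *\<^sub>R axis k (1::real)" "t *\<^sub>R axis l 1"] that by simp
    then show ?thesis
      using that r(1) by (simp add: dist_norm h_def add.assoc)
  qed
  have inS: "x + s *\<^sub>R axis k 1 + t *\<^sub>R axis l 1 \<in> S"
    if "0 \<le> s" "s \<le> h" "0 \<le> t" "t \<le> h" for s t k l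
    using near[OF that, of k l] e r by (auto simp: dist_commute)
  have dif: "f differentiable (at y)" "pd i f differentiable (at y)" "pd j f differentiable (at y)"
    if "y \<in> S" for y
    using that sm assms smooth_on_differentiable by blast+
  define \<Delta> where "\<Delta> = f (x + h *\<^sub>R axis i 1 + h *\<^sub>R axis j 1) - f (x + h *\<^sub>R axis i 1) - f (x + h *\<^sub>R axis j 1) + f x"
  obtain y where y: "dist y x < r" "\<Delta> = h * h * a y"
    using second_difference_mean_value[OF h, of f x i j] inS dif near[of _ _ i j]
    unfolding a_def \<Delta>_def by (metis less_imp_le)
  obtain z where z: "dist z x < r" "\<Delta> = h * h * b z"
    using second_difference_mean_value[OF h, of f x j i] inS dif near[of _ _ j i]
    unfolding b_def \<Delta>_def by (smt (verit, ccfv_SIG) add.commute add.left_commute)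
  have "a y = b z"
    using y z h by simp
  moreover have "dist (a y) (a x) < \<bar>a x - b x\<bar> / 2" "dist (b z) (b x) < \<bar>a x - b x\<bar> / 2"
    using d y z r by auto
  moreover have "\<bar>a x - b x\<bar> \<le> \<bar>a y - a x\<bar> + \<bar>b z - b x\<bar>"
    using \<open>a y = b z\<close> by arith
  ultimately show False
    unfolding dist_real_def by (metis add_strict_mono field_sum_of_halves not_le)
qed

subsection \<open>Zero sets of smooth functions\<close>

text \<open>Arbitrarily many disjoint translates, all of the same measure, fit into one fixed ball,
  so that measure is zero.\<close>

lemma negligible_disjoint_translates:
  fixes A :: "'a::euclidean_space set"
  assumes "compact A"
    and disj: "\<And>s t. s \<in> {0..1} \<Longrightarrow> t \<in> {0..1} \<Longrightarrow> s \<noteq> t \<Longrightarrow>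
      disjnt ((+) (s *\<^sub>R e) ` A) ((+) (t *\<^sub>R e) ` A)"
  shows "negligible A"
proof -
  obtain b where b: "\<And>x. x \<in> A \<Longrightarrow> norm x \<le> b"
    using assms(1) compact_imp_bounded bounded_iff by metis
  let ?T = "\<lambda>t. (+) (t *\<^sub>R e) ` A"
  let ?m = "measure lebesgue"
  have A: "A \<in> lmeasurable"
    using assms(1) by (rule lmeasurable_compact)
  then have T: "?T t \<in> lmeasurable" for t
    by (rule measurable_translation)
  have bound: "real N * ?m A \<le> ?m (cball (0::'a) (b + norm e))" for N :: nat
  proof -
    let ?I = "(\<lambda>k. real k / real N) ` {..<N}"
    have I: "?I \<subseteq> {0..1}" "inj_on (\<lambda>k. real k / real N) {..<N}"
      by (auto simp: inj_on_def)
    have "?m (\<Union>t\<in>?I. ?T t) = (\<Sum>t\<in>?I. ?m (?T t))"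
    proof (rule measure_UNION')
      show "pairwise (\<lambda>i j. disjnt (?T i) (?T j)) ?I"
        unfolding pairwise_def using disj I(1) by blast
    qed (use T in auto)
    also have "\<dots> = (\<Sum>t\<in>?I. ?m A)"
      by (simp add: measure_translation)
    also have "\<dots> = real N * ?m A"
      using I(2) by (simp add: card_image)
    finally have "real N * ?m A = ?m (\<Union>t\<in>?I. ?T t)"
      by simp
    also have "\<dots> \<le> ?m (cball (0::'a) (b + norm e))"
    proof (rule measure_mono_fmeasurable)
      show "(\<Union>t\<in>?I. ?T t) \<subseteq> cball 0 (b + norm e)"
      proof clarsimp
        fix k a assume "k < N" "a \<in> A"
        then have "real k / real N * norm e \<le> 1 * norm e"
          by (intro mult_right_mono) auto
        then have "norm ((real k / real N) *\<^sub>R e) \<le> norm e" "norm a \<le> b"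
          using b \<open>a \<in> A\<close> by auto
        then show "norm ((real k / real N) *\<^sub>R e + a) \<le> b + norm e"
          using norm_triangle_ineq[of "(real k / real N) *\<^sub>R e" a] by linarith
      qed
      show "(\<Union>t\<in>?I. ?T t) \<in> sets lebesgue"
        using T by (intro sets.finite_UN) auto
    qed simp
    finally show ?thesis .
  qed
  have "?m A = 0"
  proof (rule ccontr)
    assume "?m A \<noteq> 0"
    then have "?m A > 0"
      by (simp add: zero_less_measure_iff)
    then obtain N :: nat where "?m (cball (0::'a) (b + norm e)) < real N * ?m A"
      using reals_Archimedean3 by blast
    then show False
      using bound[of N] by linarith
  qed
  then show ?thesis
    using A negligible_iff_measure by blast
qed

text \<open>Near a point with nonzero \<open>pd i f\<close>, the function has at most one zero on
  each line in direction \<open>i\<close> inside a small ball. Translates of the local zero set in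
  that direction are therefore disjoint. This takes the place of describing the zero set as a graph
  by the implicit function theorem.\<close>

lemma negligible_zeros_pd_nonzero:
  assumes U: "open U" and f: "smooth_on U f"
  shows "negligible {x \<in> U. f x = 0 \<and> pd i f x \<noteq> 0}" (is "negligible ?S")
proof (subst locally_negligible_alt, rule ballI)
  fix x assume x: "x \<in> ?S"
  have "isCont (pd i f) x"
    using smooth_on_pd[OF U f] smooth_on_continuous_on continuous_on_eq_continuous_at[OF U] x by blast
  moreover have "\<bar>pd i f x\<bar> > 0"
    using x by auto
  ultimately obtain d where d: "d > 0"
      "\<And>y. dist y x < d \<Longrightarrow> dist (pd i f y) (pd i f x) < \<bar>pd i f x\<bar>"
    unfolding continuous_at_eps_delta by metis
  obtain e where e: "e > 0" "ball x e \<subseteq> U"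
    using U x openE by blast
  \<comment> \<open>Halving lets a closed ball, which makes the local zero set compact, fit inside
    both open balls.\<close>
  define r where "r = min d e / 2"
  have r: "r > 0" and rU: "cball x r \<subseteq> U" and nz: "\<And>y. y \<in> cball x r \<Longrightarrow> pd i f y \<noteq> 0"
  proof -
    show "r > 0" and "cball x r \<subseteq> U"
      using d e by (auto simp: r_def)
    show "pd i f y \<noteq> 0" if "y \<in> cball x r" for y
      using d(2)[of y] that d(1) e(1) by (auto simp: r_def dist_commute dist_real_def)
  qed
  define A where "A = {y \<in> cball x r. f y = 0}"
  have "compact A"
    unfolding A_def compact_eq_bounded_closed
  proof
    show "bounded {y \<in> cball x r. f y = 0}"
      by (rule bounded_subset[OF bounded_cball]) auto
    show "closed {y \<in> cball x r. f y = 0}"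
      using continuous_on_subset[OF smooth_on_continuous_on[OF f] rU]
      by (rule continuous_closed_preimage_constant) simp
  qed
  have no: False if y: "y \<in> A" and z: "y + t *\<^sub>R axis i 1 \<in> A" and t: "t > 0" for y t
  proof -
    have seg: "y + s *\<^sub>R axis i 1 \<in> cball x r" if "0 \<le> s" "s \<le> t" for s
    proof -
      have "(1 - s / t) *\<^sub>R y + (s / t) *\<^sub>R (y + t *\<^sub>R axis i 1) \<in> cball x r"
        using y z t that by (intro convexD[OF convex_cball]) (auto simp: A_def)
      moreover have "(1 - s / t) *\<^sub>R y + (s / t) *\<^sub>R (y + t *\<^sub>R axis i 1) = y + s *\<^sub>R axis i 1"
        using t by (simp add: algebra_simps)
      ultimately show ?thesis by simp
    qed
    have "((\<lambda>s. f (y + s *\<^sub>R axis i 1)) has_real_derivative pd i f (y + s *\<^sub>R axis i 1)) (at s)"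
      if "0 \<le> s" "s \<le> t" for s
      using pd_along_line smooth_on_differentiable[OF f] seg[OF that] rU by blast
    from MVT2[OF t this] obtain s where "0 < s" "s < t"
      "f (y + t *\<^sub>R axis i 1) - f y = t * pd i f (y + s *\<^sub>R axis i 1)"
      by auto
    then show False
      using y z t nz[OF seg[of s]] by (simp add: A_def)
  qed
  have "negligible A"
  proof (rule negligible_disjoint_translates[OF \<open>compact A\<close>])
    fix s t :: real assume "s \<noteq> t"
    have "False" if "y \<in> A" "z \<in> A" "s *\<^sub>R axis i 1 + y = t *\<^sub>R axis i 1 + z" for y z
    proof -
      \<comment> \<open>\<open>no\<close> excludes positive steps only; it applies to whichever of
        \<open>s - t\<close> and \<open>t - s\<close> is positive.\<close>
      have "z = y + (s - t) *\<^sub>R axis i 1" "y = z + (t - s) *\<^sub>R axis i 1"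
        using that(3) by (simp_all add: algebra_simps)
      then show False
        using no[of y "s - t"] no[of z "t - s"] that \<open>s \<noteq> t\<close>
        by (metis diff_gt_0_iff_gt linorder_neqE_linordered_idom)
    qed
    then show "disjnt ((+) (s *\<^sub>R axis i 1) ` A) ((+) (t *\<^sub>R axis i 1) ` A)"
      by (auto simp: disjnt_def)
  qed
  moreover have "?S \<inter> ball x r \<subseteq> A"
    by (auto simp: A_def)
  ultimately have "negligible (?S \<inter> ball x r)"
    using negligible_subset by blast
  moreover have "openin (top_of_set ?S) (?S \<inter> ball x r)" "x \<in> ?S \<inter> ball x r"
    using x r by (auto simp: openin_open)
  ultimately show "\<exists>V. openin (top_of_set ?S) V \<and> x \<in> V \<and> negligible V"
    by blast
qed

primrec flat :: "nat \<Rightarrow> (real^'n::finite \<Rightarrow> real) \<Rightarrow> real^'n \<Rightarrow> bool" where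
  "flat 0 f x \<longleftrightarrow> f x = 0"
| "flat (Suc n) f x \<longleftrightarrow> f x = 0 \<and> (\<forall>i. flat n (pd i f) x)"

lemma flat_Suc_D: "flat (Suc n) f x \<Longrightarrow> flat n f x"
  by (induction n arbitrary: f) auto

lemma flat_cong:
  assumes "open U" "x \<in> U" "\<And>y. y \<in> U \<Longrightarrow> f y = h y" "flat n f x"
  shows "flat n h x"
  using assms(3,4)
proof (induction n arbitrary: f h)
  case (Suc n)
  have "flat n (pd i h) x" for i
    by (rule Suc.IH[of "pd i f"]) (use Suc.prems in \<open>auto intro: pd_cong[OF assms(1)]\<close>)
  then show ?case
    using Suc.prems assms(2) by simp
qed (use assms(2) in simp)

lemma flat_add:
  assumes "open U" "x \<in> U" "smooth_on U f" "smooth_on U h" "flat n f x" "flat n h x"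
  shows "flat n (\<lambda>y. f y + h y) x"
  using assms(3-)
proof (induction n arbitrary: f h)
  case (Suc n)
  have "flat n (\<lambda>y. pd i f y + pd i h y) x" for i
    using Suc.prems smooth_on_pd[OF assms(1)] by (intro Suc.IH) auto
  then have "flat n (pd i (\<lambda>y. f y + h y)) x" for i
    by (rule flat_cong[OF assms(1,2), rotated])
      (simp add: pd_add smooth_on_differentiable[OF Suc.prems(1)] smooth_on_differentiable[OF Suc.prems(2)])
  then show ?case
    using Suc.prems by simp
qed simp

lemma flat_zero: "flat n (\<lambda>y. 0) x"
proof (induction n)
  case (Suc n)
  have "pd i (\<lambda>x. 0) = (\<lambda>x. 0)" for i :: 'a
    by (rule ext) simp
  then show ?case
    using Suc by simp
qed simp

text \<open>Flatness of one factor suffices: both terms of the product rule contain \<open>f\<close>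
  or one of its derivatives, each flat to the next lower order.\<close>

lemma flat_mult:
  assumes "open U" "x \<in> U" "smooth_on U f" "smooth_on U h" "flat n f x"
  shows "flat n (\<lambda>y. f y * h y) x"
  using assms(3-)
proof (induction n arbitrary: f h)
  case (Suc n)
  note sm = smooth_on_pd[OF assms(1)] smooth_on_mult[OF assms(1)]
  have "flat n (\<lambda>y. f y * pd i h y + pd i f y * h y) x" for i
    using Suc.prems flat_Suc_D[OF Suc.prems(3)] sm
    by (intro flat_add[OF assms(1,2)] Suc.IH) auto
  then have "flat n (pd i (\<lambda>y. f y * h y)) x" for i
    by (rule flat_cong[OF assms(1,2), rotated])
      (simp add: pd_mult smooth_on_differentiable[OF Suc.prems(1)] smooth_on_differentiable[OF Suc.prems(2)])
  then show ?case
    using Suc.prems by simp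
qed simp

lemma flat_sum:
  assumes "open U" "x \<in> U" "\<And>a. a \<in> A \<Longrightarrow> smooth_on U (f a)" "\<And>a. a \<in> A \<Longrightarrow> flat n (f a) x"
  shows "flat n (\<lambda>y. \<Sum>a\<in>A. f a y) x"
  using assms(3,4)
proof (induction A rule: infinite_finite_induct)
  case (insert a A)
  have "flat n (\<lambda>y. f a y + (\<Sum>a\<in>A. f a y)) x"
    using insert by (intro flat_add[OF assms(1,2)] smooth_on_sum[OF assms(1)]) auto
  then show ?case
    using insert.hyps by simp
qed (simp_all add: flat_zero)

text \<open>At a zero of \<open>f\<close>, either some partial derivative is nonzero, which happens
  on a null set, or all of them vanish and the induction hypothesis applies to each on its own zero
  set.\<close>

lemma negligible_zeros_not_flat:
  assumes "open U" "smooth_on U f"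
  shows "negligible {x \<in> U. f x = 0 \<and> \<not> flat n f x}"
  using assms(2)
proof (induction n arbitrary: f)
  case (Suc n)
  have "{x \<in> U. f x = 0 \<and> \<not> flat (Suc n) f x} \<subseteq>
      (\<Union>i\<in>UNIV. {x \<in> U. f x = 0 \<and> pd i f x \<noteq> 0} \<union> {x \<in> U. pd i f x = 0 \<and> \<not> flat n (pd i f) x})"
    by auto
  moreover have "negligible \<dots>"
    using Suc.IH smooth_on_pd[OF assms(1)] negligible_zeros_pd_nonzero[OF assms(1)] Suc.prems
    by (intro negligible_Union) (auto intro!: negligible_Un)
  ultimately show ?case
    by (metis (lifting) negligible_subset)
qed simp

subsection \<open>Overdetermined systems of finite type\<close>

text \<open>Stands for "is a linear combination of the unknowns with continuous coefficients", where
  \<omega> is the sum of the absolute values of the unknowns. The constant may depend on the compact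
  set, so multiplication by any continuous function is allowed.\<close>

definition dominated :: "'a::topological_space set \<Rightarrow> ('a \<Rightarrow> real) \<Rightarrow> ('a \<Rightarrow> real) \<Rightarrow> bool" where
  "dominated U \<omega> f \<longleftrightarrow> (\<forall>C. compact C \<and> C \<subseteq> U \<longrightarrow> (\<exists>B. \<forall>y\<in>C. \<bar>f y\<bar> \<le> B * \<omega> y))"

lemma dominated_leI:
  assumes "\<And>y. y \<in> U \<Longrightarrow> \<bar>f y\<bar> \<le> \<omega> y"
  shows "dominated U \<omega> f"
  unfolding dominated_def using assms by (intro allI impI exI[of _ 1]) auto

lemma dominated_cong:
  assumes "dominated U \<omega> f" "\<And>y. y \<in> U \<Longrightarrow> f y = h y"
  shows "dominated U \<omega> h"
  unfolding dominated_def
proof (intro allI impI)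
  fix C assume C: "compact C \<and> C \<subseteq> U"
  then obtain B where "\<forall>y\<in>C. \<bar>f y\<bar> \<le> B * \<omega> y"
    using assms(1) unfolding dominated_def by blast
  then show "\<exists>B. \<forall>y\<in>C. \<bar>h y\<bar> \<le> B * \<omega> y"
    using assms(2) C by (metis subsetD)
qed

lemma dominated_zero: "dominated U \<omega> (\<lambda>y. 0)"
  unfolding dominated_def by (auto intro: exI[of _ 0])

lemma dominated_add:
  assumes "dominated U \<omega> f" "dominated U \<omega> h"
  shows "dominated U \<omega> (\<lambda>y. f y + h y)"
  unfolding dominated_def
proof (intro allI impI)
  fix C assume C: "compact C \<and> C \<subseteq> U"
  then obtain B B' where "\<forall>y\<in>C. \<bar>f y\<bar> \<le> B * \<omega> y" "\<forall>y\<in>C. \<bar>h y\<bar> \<le> B' * \<omega> y"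
    using assms unfolding dominated_def by meson
  then have "\<forall>y\<in>C. \<bar>f y + h y\<bar> \<le> (B + B') * \<omega> y"
    by (auto simp: distrib_right intro: order_trans[OF abs_triangle_ineq add_mono])
  then show "\<exists>B. \<forall>y\<in>C. \<bar>f y + h y\<bar> \<le> B * \<omega> y" ..
qed

lemma dominated_mult:
  assumes "continuous_on U h" "dominated U \<omega> f"
  shows "dominated U \<omega> (\<lambda>y. h y * f y)"
  unfolding dominated_def
proof (intro allI impI)
  fix C assume C: "compact C \<and> C \<subseteq> U"
  then obtain B where B: "\<forall>y\<in>C. \<bar>f y\<bar> \<le> B * \<omega> y"
    using assms(2) unfolding dominated_def by blast
  have "compact (h ` C)"
    using C assms(1) continuous_on_subset compact_continuous_image by blast
  then obtain M where M: "\<forall>y\<in>C. \<bar>h y\<bar> \<le> M"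
    using compact_imp_bounded[of "h ` C"] by (auto simp: bounded_iff)
  have "\<forall>y\<in>C. \<bar>h y * f y\<bar> \<le> (M * B) * \<omega> y"
  proof
    fix y assume y: "y \<in> C"
    have "\<bar>h y\<bar> * \<bar>f y\<bar> \<le> M * (B * \<omega> y)"
      using B M y by (intro mult_mono) (auto intro: order_trans[OF abs_ge_zero])
    then show "\<bar>h y * f y\<bar> \<le> (M * B) * \<omega> y"
      by (simp add: abs_mult mult.assoc)
  qed
  then show "\<exists>B. \<forall>y\<in>C. \<bar>h y * f y\<bar> \<le> B * \<omega> y" ..
qed

lemma dominated_cmult: "dominated U \<omega> f \<Longrightarrow> dominated U \<omega> (\<lambda>y. c * f y)"
  by (intro dominated_mult continuous_on_const)

lemma dominated_sum:
  "(\<And>a. a \<in> A \<Longrightarrow> dominated U \<omega> (f a)) \<Longrightarrow> dominated U \<omega> (\<lambda>y. \<Sum>a\<in>A. f a y)"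
  by (induction A rule: infinite_finite_induct) (auto intro: dominated_zero dominated_add)

lemma norm_diff_le_pd:
  fixes f :: "real^'n::finite \<Rightarrow> real"
  assumes C: "convex C" "x \<in> C" "y \<in> C"
    and f: "\<And>z. z \<in> C \<Longrightarrow> f differentiable (at z)"
    and B: "\<And>z i. z \<in> C \<Longrightarrow> \<bar>pd i f z\<bar> \<le> B"
  shows "\<bar>f x - f y\<bar> \<le> real CARD('n) * B * norm (x - y)"
proof -
  have "norm (f x - f y) \<le> (real CARD('n) * B) * norm (x - y)"
  proof (rule differentiable_bound[OF C(1) _ _ C(2,3)])
    show "(f has_derivative (\<lambda>v. \<Sum>i\<in>UNIV. v $ i * pd i f z)) (at z within C)" if "z \<in> C" for z
      using has_derivative_pd[OF f[OF that]] has_derivative_at_withinI by blast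
    show "onorm (\<lambda>v. \<Sum>i\<in>UNIV. v $ i * pd i f z) \<le> real CARD('n) * B" if z: "z \<in> C" for z
    proof (rule onorm_le)
      fix v :: "real^'n"
      have "norm (\<Sum>i\<in>UNIV. v $ i * pd i f z) \<le> (\<Sum>i\<in>(UNIV::'n set). norm v * B)"
      proof (rule order_trans[OF norm_sum sum_mono])
        fix i
        show "norm (v $ i * pd i f z) \<le> norm v * B"
          unfolding norm_mult by (intro mult_mono) (use B[OF z] component_le_norm_cart in auto)
      qed
      then show "norm (\<Sum>i\<in>UNIV. v $ i * pd i f z) \<le> real CARD('n) * B * norm v"
        by (simp add: mult_ac)
    qed
  qed
  then show ?thesis by simp
qed

text \<open>The common zero set is closed in \<open>U\<close>; it is also open, because on a small
  ball around a zero the maximum of \<omega> is at most half of itself. Connectedness then spreads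
  the zero over \<open>U\<close>.\<close>

lemma finite_type_unique:
  fixes W :: "'q \<Rightarrow> real^'n::finite \<Rightarrow> real"
  assumes U: "open U" "connected U" and Q: "finite Q"
    and W: "\<And>q. q \<in> Q \<Longrightarrow> smooth_on U (W q)"
    and dom: "\<And>q i. q \<in> Q \<Longrightarrow> dominated U (\<lambda>y. \<Sum>q\<in>Q. \<bar>W q y\<bar>) (pd i (W q))"
    and x0: "x0 \<in> U" "\<And>q. q \<in> Q \<Longrightarrow> W q x0 = 0"
    and x: "x \<in> U" and q: "q \<in> Q"
  shows "W q x = 0"
proof -
  define \<omega> where "\<omega> = (\<lambda>y. \<Sum>q\<in>Q. \<bar>W q y\<bar>)"
  have \<omega>_cont: "continuous_on U \<omega>"
    unfolding \<omega>_def using W smooth_on_continuous_on by (intro continuous_intros) auto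
  have \<omega>_nonneg: "\<omega> y \<ge> 0" for y
    by (auto simp: \<omega>_def intro: sum_nonneg)
  have \<omega>_zero: "\<omega> y = 0 \<longleftrightarrow> (\<forall>q\<in>Q. W q y = 0)" for y
    unfolding \<omega>_def using Q by (subst sum_nonneg_eq_0_iff) auto
  have "\<exists>r>0. ball z r \<subseteq> {y \<in> U. \<omega> y = 0}" if z: "z \<in> U" "\<omega> z = 0" for z
  proof -
    obtain r0 where r0: "r0 > 0" "cball z r0 \<subseteq> U"
      using z(1) open_contains_cball_eq[OF U(1)] by auto
    have "\<exists>B. \<forall>y\<in>cball z r0. \<bar>pd i (W q) y\<bar> \<le> B * \<omega> y" if "q \<in> Q" for q i
      using dom[OF that, of i] r0(2) compact_cball[of z r0] unfolding dominated_def \<omega>_def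
      by (elim allE[of _ "cball z r0"]) simp
    then obtain b where b: "\<And>q i y. q \<in> Q \<Longrightarrow> y \<in> cball z r0 \<Longrightarrow> \<bar>pd i (W q) y\<bar> \<le> b q i * \<omega> y"
      by metis
    \<comment> \<open>Absolute values are taken because \<open>dominated\<close> puts no sign on its
      constant.\<close>
    define B where "B = (\<Sum>q\<in>Q. \<Sum>i\<in>UNIV. \<bar>b q i\<bar>)"
    have B0: "B \<ge> 0"
      by (auto simp: B_def intro!: sum_nonneg)
    have B: "\<bar>pd i (W q) y\<bar> \<le> B * \<omega> y" if "q \<in> Q" "y \<in> cball z r0" for q i y
    proof -
      have "b q i \<le> \<bar>b q i\<bar>"
        by simp
      also have "\<dots> \<le> (\<Sum>i\<in>UNIV. \<bar>b q i\<bar>)"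
        by (rule member_le_sum) auto
      also have "\<dots> \<le> B"
        unfolding B_def using that Q by (intro member_le_sum) (auto intro: sum_nonneg)
      finally show ?thesis
        using b[OF that, of i] \<omega>_nonneg[of y] by (meson mult_right_mono order_trans)
    qed
    define c where "c = real (card Q) * (real CARD('n) * B)"
    have c0: "c \<ge> 0"
      using B0 by (simp add: c_def)
    \<comment> \<open>Chosen so that \<open>c * r\<close> is at most 1/2; the added 1 covers the
      case \<open>c = 0\<close>.\<close>
    define r where "r = min r0 (1 / (2 * (c + 1)))"
    have r: "r > 0" "r \<le> r0" "c * r \<le> 1 / 2"
    proof -
      show "r > 0" "r \<le> r0"
        using r0 c0 by (auto simp: r_def)
      have "c * r \<le> c * (1 / (2 * (c + 1)))"
        using c0 by (intro mult_left_mono) (auto simp: r_def)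
      also have "\<dots> \<le> 1 / 2"
        using c0 by (simp add: field_simps)
      finally show "c * r \<le> 1 / 2" .
    qed
    have sub: "cball z r \<subseteq> cball z r0"
      using r by auto
    have "continuous_on (cball z r) \<omega>"
      using \<omega>_cont sub r0 by (meson continuous_on_subset order_trans)
    \<comment> \<open>At the maximum point the bounds on all derivatives in the ball are expressed
      by \<omega> at that same point, so the estimate closes up.\<close>
    then obtain y where y: "y \<in> cball z r" "\<And>w. w \<in> cball z r \<Longrightarrow> \<omega> w \<le> \<omega> y"
      using continuous_attains_sup[of "cball z r" \<omega>] r by auto
    have "\<bar>W q y\<bar> \<le> real CARD('n) * (B * \<omega> y) * r" if q: "q \<in> Q" for q
    proof -
      have "\<bar>W q y - W q z\<bar> \<le> real CARD('n) * (B * \<omega> y) * norm (y - z)"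
      proof (rule norm_diff_le_pd[OF convex_cball y(1)])
        show "z \<in> cball z r"
          using r by simp
        fix w assume w: "w \<in> cball z r"
        then show "W q differentiable (at w)"
          using W[OF q] sub r0 smooth_on_differentiable by blast
        fix i
        have "\<bar>pd i (W q) w\<bar> \<le> B * \<omega> w"
          using B[OF q] w sub by blast
        also have "\<dots> \<le> B * \<omega> y"
          using y w B0 by (intro mult_left_mono) auto
        finally show "\<bar>pd i (W q) w\<bar> \<le> B * \<omega> y" .
      qed
      also have "\<dots> \<le> real CARD('n) * (B * \<omega> y) * r"
        using y(1) B0 \<omega>_nonneg by (intro mult_left_mono) (auto simp: dist_norm norm_minus_commute)
      finally show ?thesis
        using z(2) \<omega>_zero q by simp
    qed
    then have "\<omega> y \<le> (\<Sum>q\<in>Q. real CARD('n) * (B * \<omega> y) * r)"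
      unfolding \<omega>_def by (intro sum_mono) (simp add: \<omega>_def)
    also have "\<dots> = c * r * \<omega> y"
      by (simp add: c_def mult_ac)
    also have "\<dots> \<le> 1 / 2 * \<omega> y"
      using r(3) \<omega>_nonneg by (intro mult_right_mono)
    finally have "\<omega> y = 0"
      using \<omega>_nonneg[of y] by simp
    then have "\<omega> w = 0" if "w \<in> ball z r" for w
      using y(2)[of w] \<omega>_nonneg[of w] that by simp
    moreover have "ball z r \<subseteq> U"
      using ball_subset_cball sub r0(2) by (meson order_trans)
    ultimately show ?thesis
      using r(1) by (intro exI[of _ r]) auto
  qed
  then have "open {y \<in> U. \<omega> y = 0}"
    unfolding open_contains_ball by blast
  then have "\<forall>y\<in>U. \<omega> y = 0"
    using continuous_levelset_open[OF U(2) \<omega>_cont] x0 \<omega>_zero by blast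
  then show ?thesis
    using x q \<omega>_zero by blast
qed

subsection \<open>Prolongation of the Killing equation\<close>

text \<open>Polarization: the trilinear form vanishes on the diagonal, and inclusion-exclusion over
  the sums of three axis vectors isolates its six mixed terms.\<close>

lemma cubic_form_symmetrization_zero:
  fixes F :: "'n::finite \<Rightarrow> 'n \<Rightarrow> 'n \<Rightarrow> real"
  assumes "\<And>v :: real^'n. (\<Sum>c\<in>UNIV. \<Sum>i\<in>UNIV. \<Sum>j\<in>UNIV. v $ c * v $ i * v $ j * F c i j) = 0"
  shows "F c i j + F c j i + F i c j + F i j c + F j c i + F j i c = 0"
proof -
  define T where "T = (\<lambda>u v w :: real^'n. \<Sum>c\<in>UNIV. u $ c * (\<Sum>i\<in>UNIV. v $ i * (\<Sum>j\<in>UNIV. w $ j * F c i j)))"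
  have add: "T (u + u') v w = T u v w + T u' v w" "T u (v + v') w = T u v w + T u v' w"
    "T u v (w + w') = T u v w + T u v w'" for u u' v v' w w'
    by (simp_all add: T_def algebra_simps sum.distrib)
  have T_axis: "T (axis a 1) (axis b 1) (axis d 1) = F a b d" for a b d
    by (simp add: T_def axis_def if_distrib[where f = "\<lambda>c. c * _"] if_distrib[where f = "\<lambda>c. _ * c"]
        cong: if_cong)
  have diag: "T v v v = 0" for v
    using assms[of v] by (simp add: T_def sum_distrib_left mult.assoc)
  define a b d where "a = (axis c 1 :: real^'n)" and "b = (axis i 1 :: real^'n)" and "d = (axis j 1 :: real^'n)"
  have "T a b d + T a d b + T b a d + T b d a + T d a b + T d b a = 0"
    using diag[of "a + b + d"] diag[of "a + b"] diag[of "a + d"] diag[of "b + d"] diag[of a] diag[of b] diag[of d]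
    unfolding add by linarith
  then show ?thesis
    by (simp add: a_def b_def d_def T_axis)
qed

text \<open>For five fixed indices, a tensor symmetric in its first three and last two slots has ten
  components, labelled by the pair in the last slots. Symmetrizing over the last three slots acts on
  them as the adjacency matrix \<open>A\<close> of the Petersen graph, and \<open>(A + 1) A = J + 2\<close>, \<open>J A = 3 J\<close>
  give the inverse \<open>(A + 1) / 2 - J / 6\<close> used here.\<close>

lemma prolongation_inverse:
  fixes T :: "'n \<Rightarrow> 'n \<Rightarrow> 'n \<Rightarrow> 'n \<Rightarrow> 'n \<Rightarrow> real"
  assumes s: "\<And>a b c i j. T a b c i j = T b a c i j" "\<And>a b c i j. T a b c i j = T a c b i j"
      "\<And>a b c i j. T a b c i j = T a b c j i"
    and R: "\<And>a b c i j. R a b c i j = T a b c i j + T a b i j c + T a b j c i"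
  shows "T a b c i j =
     1 / 2 * (R i j a b c + R a b c i j + R a c b i j + R b c a i j)
     + (- 1 / 6) * (R i j a b c + R a b c i j + R a c b i j + R b c a i j
       + R i a j b c + R i b j a c + R i c j a b + R j a i b c + R j b i a c + R j c i a b)"
proof -
  show ?thesis
    unfolding R by (simp add: s) (simp add: field_simps)
qed

section \<open>The prolonged Killing system and its uniqueness\<close>

lemma pd_pd_cong:
  assumes "open U" "x \<in> U" "\<And>y. y \<in> U \<Longrightarrow> f y = h y"
  shows "pd a (pd b f) x = pd a (pd b h) x"
  by (rule pd_cong[OF assms(1,2)]) (rule pd_cong[OF assms(1)], auto intro: assms(3))

lemma pd_pd_add:
  assumes "open U" "x \<in> U" "smooth_on U f" "smooth_on U h"
  shows "pd a (pd b (\<lambda>y. f y + h y)) x = pd a (pd b f) x + pd a (pd b h) x"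
proof -
  note d = smooth_on_differentiable[OF assms(3)] smooth_on_differentiable[OF assms(4)]
    smooth_on_differentiable[OF smooth_on_pd[OF assms(1,3)]]
    smooth_on_differentiable[OF smooth_on_pd[OF assms(1,4)]]
  have "pd a (pd b (\<lambda>y. f y + h y)) x = pd a (\<lambda>y. pd b f y + pd b h y) x"
    by (rule pd_cong[OF assms(1,2)]) (simp add: pd_add d)
  then show ?thesis
    using assms(2) by (simp add: pd_add d)
qed

lemma pd_pd_sum:
  assumes "open U" "x \<in> U" "\<And>s. s \<in> A \<Longrightarrow> smooth_on U (f s)"
  shows "pd a (pd b (\<lambda>y. \<Sum>s\<in>A. f s y)) x = (\<Sum>s\<in>A. pd a (pd b (f s)) x)"
proof -
  have "pd a (pd b (\<lambda>y. \<Sum>s\<in>A. f s y)) x = pd a (\<lambda>y. \<Sum>s\<in>A. pd b (f s) y) x"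
    by (rule pd_cong[OF assms(1,2)]) (simp add: pd_sum smooth_on_differentiable[OF assms(3)])
  then show ?thesis
    using assms(2) by (simp add: pd_sum smooth_on_differentiable[OF smooth_on_pd[OF assms(1,3)]])
qed

lemma pd_pd_mult:
  assumes "open U" "x \<in> U" "smooth_on U f" "smooth_on U h"
  shows "pd a (pd b (\<lambda>y. f y * h y)) x =
    f x * pd a (pd b h) x + pd a f x * pd b h x + pd b f x * pd a h x + pd a (pd b f) x * h x"
proof -
  note d = smooth_on_differentiable[OF assms(3)] smooth_on_differentiable[OF assms(4)]
    smooth_on_differentiable[OF smooth_on_pd[OF assms(1,3)]]
    smooth_on_differentiable[OF smooth_on_pd[OF assms(1,4)]]
  have "pd a (pd b (\<lambda>y. f y * h y)) x = pd a (\<lambda>y. f y * pd b h y + pd b f y * h y) x"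
    by (rule pd_cong[OF assms(1,2)]) (simp add: pd_mult d)
  then show ?thesis
    using assms(2) by (simp add: pd_mult pd_add d differentiable_mult)
qed

text \<open>The unknowns are all components of the 2-jet of \<open>k\<close>. Two derivatives of the
  Killing equation bound the cyclic sums of third derivatives by the unknowns, and
  \<open>prolongation_inverse\<close> recovers each single third derivative from these sums. The
  system is then of finite type.\<close>

lemma killing_jet_unique:
  fixes k :: "'n::finite \<Rightarrow> 'n \<Rightarrow> real^'n \<Rightarrow> real"
    and M :: "'n \<Rightarrow> 'n \<Rightarrow> 'n \<Rightarrow> real^'n \<Rightarrow> real"
  assumes U: "open U" "connected U"
    and k: "\<And>i j. smooth_on U (k i j)"
    and M: "\<And>c i s. smooth_on U (M c i s)"
    and sym: "\<And>i j x. x \<in> U \<Longrightarrow> k i j x = k j i x"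
    and killing: "\<And>x v :: real^'n. x \<in> U \<Longrightarrow>
       (\<Sum>c\<in>UNIV. \<Sum>i\<in>UNIV. \<Sum>j\<in>UNIV.
         v $ c * v $ i * v $ j * (pd c (k i j) x - (\<Sum>s\<in>UNIV. M c i s x * k s j x))) = 0"
    and x0: "x0 \<in> U" "\<And>i j. flat 2 (k i j) x0"
    and x: "x \<in> U"
  shows "k i j x = 0"
proof -
  \<comment> \<open>\<open>None\<close> means no differentiation, so one finite index type lists
    \<open>k\<close> and its first and second derivatives; first derivatives occur twice, which only
    enlarges \<omega>.\<close>
  define dop where "dop = (\<lambda>a (f :: real^'n \<Rightarrow> real). case a of None \<Rightarrow> f | Some a \<Rightarrow> pd a f)"
  have dop: "dop None f = f" "dop (Some a) f = pd a f" for a f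
    by (simp_all add: dop_def)
  define W where "W = (\<lambda>(a, b, i, j). dop a (dop b (k i j)))"
  define \<omega> where "\<omega> = (\<lambda>y. \<Sum>q\<in>UNIV. \<bar>W q y\<bar>)"
  note pdU = smooth_on_pd[OF U(1)]
  have W_smooth: "smooth_on U (W q)" for q
  proof (cases q)
    case (fields a b i j)
    then show ?thesis
      unfolding W_def by (cases a; cases b) (simp_all add: dop k pdU)
  qed
  have W_dom: "dominated U \<omega> (W q)" for q
    by (rule dominated_leI) (auto simp: \<omega>_def intro: member_le_sum)
  have k_dom: "dominated U \<omega> (k i j)" "dominated U \<omega> (pd a (k i j))"
    "dominated U \<omega> (pd a (pd b (k i j)))" for a b i j
    using W_dom[of "(None, None, i, j)"] W_dom[of "(Some a, None, i, j)"] W_dom[of "(Some a, Some b, i, j)"]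
    by (simp_all add: W_def dop)
  define N where "N = (\<lambda>c i j y. \<Sum>s\<in>UNIV. M c i s y * k s j y)"
  have N_smooth: "smooth_on U (N c i j)" for c i j
    unfolding N_def by (intro smooth_on_sum smooth_on_mult U k M)
  have N_dom: "dominated U \<omega> (pd a (pd b (N c i j)))" for a b c i j
  proof -
    have "dominated U \<omega> (\<lambda>y. \<Sum>s\<in>UNIV. M c i s y * pd a (pd b (k s j)) y + pd a (M c i s) y * pd b (k s j) y
        + pd b (M c i s) y * pd a (k s j) y + pd a (pd b (M c i s)) y * k s j y)"
      by (intro dominated_sum dominated_add dominated_mult k_dom smooth_on_continuous_on M pdU)
    then show ?thesis
      by (rule dominated_cong) (simp add: N_def pd_pd_sum[OF U(1)] pd_pd_mult[OF U(1)] smooth_on_mult U k M)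
  qed
  define R where "R = (\<lambda>a b c i j y. pd a (pd b (pd c (k i j))) y + pd a (pd b (pd i (k j c))) y
     + pd a (pd b (pd j (k c i))) y)"
  have R_dom: "dominated U \<omega> (R a b c i j)" for a b c i j
  proof -
    let ?S = "\<lambda>y. pd c (k i j) y + pd i (k j c) y + pd j (k c i) y"
    let ?N = "\<lambda>y. N c i j y + N c j i y + N i c j y + N i j c y + N j c i y + N j i c y"
    \<comment> \<open>Among the six permutations of the indices each term of \<open>?S\<close>
      occurs twice, by the symmetry of \<open>k\<close>; hence the doubled sum and the later factor
      1/2.\<close>
    have S: "?S y + ?S y = ?N y" if y: "y \<in> U" for y
    proof -
      have "pd c (k i j) y = pd c (k j i) y" for c i j
        using pd_cong[OF U(1) y] sym by blast
      then show ?thesis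
        using cubic_form_symmetrization_zero[of "\<lambda>c i j. pd c (k i j) y - N c i j y" c i j] killing[OF y]
        unfolding N_def by (smt (verit, best))
    qed
    have "R a b c i j y + R a b c i j y = pd a (pd b (\<lambda>y. ?S y + ?S y)) y" if "y \<in> U" for y
    proof -
      have "R a b c i j y = pd a (pd b ?S) y"
        using that by (simp add: R_def pd_pd_add[OF U(1)] smooth_on_add U k pdU)
      moreover have "pd a (pd b (\<lambda>y. ?S y + ?S y)) y = pd a (pd b ?S) y + pd a (pd b ?S) y"
        using that by (rule pd_pd_add[OF U(1)]) (intro smooth_on_add U k pdU)+
      ultimately show ?thesis
        by simp
    qed
    moreover have "pd a (pd b (\<lambda>y. ?S y + ?S y)) y = pd a (pd b ?N) y" if "y \<in> U" for y
      by (rule pd_pd_cong[OF U(1) that S])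
    moreover have "pd a (pd b ?N) y = pd a (pd b (N c i j)) y + pd a (pd b (N c j i)) y
        + pd a (pd b (N i c j)) y + pd a (pd b (N i j c)) y + pd a (pd b (N j c i)) y
        + pd a (pd b (N j i c)) y" if "y \<in> U" for y
      using that by (simp add: pd_pd_add[OF U(1)] smooth_on_add U N_smooth)
    ultimately have R: "R a b c i j y = 1 / 2 * (pd a (pd b (N c i j)) y + pd a (pd b (N c j i)) y
        + pd a (pd b (N i c j)) y + pd a (pd b (N i j c)) y + pd a (pd b (N j c i)) y
        + pd a (pd b (N j i c)) y)" if "y \<in> U" for y
      using that by fastforce
    have "dominated U \<omega> (\<lambda>y. 1 / 2 * (pd a (pd b (N c i j)) y + pd a (pd b (N c j i)) y
        + pd a (pd b (N i c j)) y + pd a (pd b (N i j c)) y + pd a (pd b (N j c i)) y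
        + pd a (pd b (N j i c)) y))"
      by (intro dominated_cmult dominated_add N_dom)
    then show ?thesis
      by (rule dominated_cong) (simp only: R)
  qed
  have T_dom: "dominated U \<omega> (pd a (pd b (pd c (k i j))))" for a b c i j
  proof -
    have "dominated U \<omega> (\<lambda>y. 1 / 2 * (R i j a b c y + R a b c i j y + R a c b i j y + R b c a i j y)
     + (- 1 / 6) * (R i j a b c y + R a b c i j y + R a c b i j y + R b c a i j y
       + R i a j b c y + R i b j a c y + R i c j a b y + R j a i b c y + R j b i a c y + R j c i a b y))"
      by (intro dominated_add dominated_cmult R_dom)
    then show ?thesis
    proof (rule dominated_cong)
      fix y assume y: "y \<in> U"
      show "1 / 2 * (R i j a b c y + R a b c i j y + R a c b i j y + R b c a i j y)
     + (- 1 / 6) * (R i j a b c y + R a b c i j y + R a c b i j y + R b c a i j y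
       + R i a j b c y + R i b j a c y + R i c j a b y + R j a i b c y + R j b i a c y + R j c i a b y)
        = pd a (pd b (pd c (k i j))) y"
      proof (rule prolongation_inverse[of "\<lambda>a b c i j. pd a (pd b (pd c (k i j))) y", symmetric])
        fix a b c i j
        show "pd a (pd b (pd c (k i j))) y = pd b (pd a (pd c (k i j))) y"
          by (rule pd_commute[OF U(1) _ y]) (intro pdU k)
        show "pd a (pd b (pd c (k i j))) y = pd a (pd c (pd b (k i j))) y"
          by (rule pd_cong[OF U(1) y]) (rule pd_commute[OF U(1) k])
        show "pd a (pd b (pd c (k i j))) y = pd a (pd b (pd c (k j i))) y"
          by (rule pd_pd_cong[OF U(1) y]) (rule pd_cong[OF U(1)], auto intro: sym)
      qed (simp add: R_def)
    qed
  qed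
  have dW: "dominated U \<omega> (pd c (W q))" for c q
  proof (cases q)
    case (fields a b i j)
    show ?thesis
      unfolding fields W_def by (cases a; cases b) (simp_all add: dop k_dom T_dom)
  qed
  have "W q x0 = 0" for q
  proof (cases q)
    case (fields a b i j)
    show ?thesis
      unfolding fields W_def using x0(2)[of i j]
      by (cases a; cases b) (simp_all add: dop numeral_2_eq_2)
  qed
  then have "W (None, None, i, j) x = 0"
    using finite_type_unique[OF U _ _ _ x0(1) _ x, of UNIV W "(None, None, i, j)"] W_smooth dW
    unfolding \<omega>_def by auto
  then show ?thesis
    by (simp add: W_def dop)
qed

section \<open>The Killing equation in matrix notation, as a Poisson bracket\<close>

definition pdm :: "'n::finite \<Rightarrow> (real^'n \<Rightarrow> real^'n^'n) \<Rightarrow> real^'n \<Rightarrow> real^'n^'n" where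
  "pdm l A x = (\<chi> i j. pd l (\<lambda>y. A y $ i $ j) x)"

lemma smooth_matrix_field_pdm:
  "open U \<Longrightarrow> smooth_matrix_field U A \<Longrightarrow> smooth_matrix_field U (pdm l A)"
  by (simp add: smooth_matrix_field_def pdm_def smooth_on_pd)

lemma smooth_matrix_field_mult:
  "open U \<Longrightarrow> smooth_matrix_field U A \<Longrightarrow> smooth_matrix_field U B \<Longrightarrow>
    smooth_matrix_field U (\<lambda>x. A x ** B x)"
  by (auto simp: smooth_matrix_field_def matrix_matrix_mult_def intro!: smooth_on_sum smooth_on_mult)

lemma pdm_mult:
  assumes "open U" "x \<in> U" "smooth_matrix_field U A" "smooth_matrix_field U B"
  shows "pdm l (\<lambda>y. A y ** B y) x = pdm l A x ** B x + A x ** pdm l B x"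
proof -
  have d: "(\<lambda>y. A y $ i $ j) differentiable (at x)" "(\<lambda>y. B y $ i $ j) differentiable (at x)" for i j
    using assms smooth_on_differentiable unfolding smooth_matrix_field_def by blast+
  show ?thesis
    by (simp add: vec_eq_iff pdm_def matrix_matrix_mult_def pd_sum pd_mult d differentiable_mult
        sum.distrib add.commute)
qed

lemma symmetric_matrix_nth: "symmetric_matrix A \<Longrightarrow> A $ i $ j = A $ j $ i"
  unfolding symmetric_matrix_def by (metis (no_types) transpose_def vec_lambda_beta)

lemma matrix_add_rdistrib: "(A + B) ** C = A ** C + B ** C" for A B :: "real^'n^'m"
  by (simp add: vec_eq_iff matrix_matrix_mult_def distrib_right sum.distrib)

lemma matrix_vector_mult_sum_scaleR:
  "(\<Sum>\<alpha>\<in>A. c \<alpha> *\<^sub>R B \<alpha>) *v p = (\<Sum>\<alpha>\<in>A. c \<alpha> *\<^sub>R (B \<alpha> *v p))"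
  for B :: "'a \<Rightarrow> real^'n^'m"
  by (induction A rule: infinite_finite_induct)
    (auto simp: matrix_vector_mult_add_rdistrib scaleR_matrix_vector_assoc)

lemma inner_matrix_vector_sum:
  "v \<bullet> (A *v w) = (\<Sum>i\<in>UNIV. \<Sum>j\<in>UNIV. v $ i * w $ j * A $ i $ j)" for A :: "real^'n^'m"
  by (simp add: inner_vec_def matrix_vector_mult_def sum_distrib_left mult_ac)

lemma inner_transpose_matrix_vector: "(transpose A *v v) \<bullet> w = v \<bullet> (A *v w)" for A :: "real^'n^'m"
  by (simp add: transpose_matrix_vector dot_lmul_matrix)

lemma quadratic_form_transpose: "v \<bullet> (transpose A *v v) = v \<bullet> (A *v v)" for A :: "real^'n^'n"
  by (metis inner_commute inner_transpose_matrix_vector)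

lemma quadratic_form_congruence: "v \<bullet> ((transpose S ** A ** S) *v v) = (S *v v) \<bullet> (A *v (S *v v))"
  for A :: "real^'n^'n" and S :: "real^'m^'n"
  by (metis inner_transpose_matrix_vector matrix_vector_mul_assoc transpose_transpose)

lemma quad_fun_has_derivative:
  fixes A :: "real^'n::finite \<Rightarrow> real^'n^'n"
  assumes "smooth_matrix_field U A" "x \<in> U"
  shows "(quad_fun A has_derivative (\<lambda>h. \<Sum>i\<in>UNIV. \<Sum>j\<in>UNIV.
     (p $ i * p $ j) * (\<Sum>l\<in>UNIV. fst h $ l * pd l (\<lambda>y. A y $ i $ j) x)
     + (p $ i * snd h $ j + snd h $ i * p $ j) * A x $ i $ j)) (at (x, p))"
proof -
  have A: "((\<lambda>z :: (real^'n) \<times> (real^'n). A (fst z) $ i $ j) has_derivative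
      (\<lambda>h. \<Sum>l\<in>UNIV. fst h $ l * pd l (\<lambda>y. A y $ i $ j) x)) (at (x, p))" for i j
  proof -
    have "(\<lambda>y. A y $ i $ j) differentiable (at (fst (x, p)))"
      using assms smooth_on_differentiable[of U] unfolding smooth_matrix_field_def by auto
    from has_derivative_compose[OF has_derivative_fst[OF has_derivative_ident] has_derivative_pd[OF this]]
    show ?thesis by simp
  qed
  have s: "((\<lambda>z :: (real^'n) \<times> (real^'n). snd z $ i) has_derivative (\<lambda>h. snd h $ i)) (at (x, p))" for i
    using bounded_linear.has_derivative[OF bounded_linear_vec_nth has_derivative_snd[OF has_derivative_ident]] .
  have "quad_fun A = (\<lambda>z. \<Sum>i\<in>UNIV. \<Sum>j\<in>UNIV. (snd z $ i * snd z $ j) * A (fst z) $ i $ j)"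
    by (rule ext) (simp add: quad_fun_def inner_matrix_vector_sum)
  moreover have "((\<lambda>z. \<Sum>i\<in>UNIV. \<Sum>j\<in>UNIV. (snd z $ i * snd z $ j) * A (fst z) $ i $ j) has_derivative
     (\<lambda>h. \<Sum>i\<in>UNIV. \<Sum>j\<in>UNIV.
     (p $ i * p $ j) * (\<Sum>l\<in>UNIV. fst h $ l * pd l (\<lambda>y. A y $ i $ j) x)
     + (p $ i * snd h $ j + snd h $ i * p $ j) * A x $ i $ j)) (at (x, p))"
    using has_derivative_mult[OF has_derivative_mult[OF s s] A]
    by (intro has_derivative_sum) simp
  ultimately show ?thesis by simp
qed

lemma quad_fun_derivative_axis:
  fixes A :: "real^'n::finite \<Rightarrow> real^'n^'n"
  assumes "smooth_matrix_field U A" "x \<in> U" "symmetric_matrix (A x)"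
  shows "frechet_derivative (quad_fun A) (at (x, p)) (axis l 1, 0) = p \<bullet> (pdm l A x *v p)"
    and "frechet_derivative (quad_fun A) (at (x, p)) (0, axis l 1) = 2 * (A x *v p) $ l"
proof -
  note d = frechet_derivative_at[OF quad_fun_has_derivative[OF assms(1,2), of p], symmetric]
  note ax = axis_def if_distrib[where f = "\<lambda>c. c * _"] if_distrib[where f = "\<lambda>c. _ * c"]
  have sym: "A x $ i $ j = A x $ j $ i" for i j
    using assms(3) by (rule symmetric_matrix_nth)
  show "frechet_derivative (quad_fun A) (at (x, p)) (axis l 1, 0) = p \<bullet> (pdm l A x *v p)"
    by (simp add: d ax inner_matrix_vector_sum pdm_def cong: if_cong)
  have "frechet_derivative (quad_fun A) (at (x, p)) (0, axis l 1)
      = (\<Sum>i\<in>UNIV. \<Sum>j\<in>UNIV. axis l 1 $ j * (p $ i * A x $ i $ j))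
        + (\<Sum>i\<in>UNIV. axis l 1 $ i * (\<Sum>j\<in>UNIV. p $ j * A x $ i $ j))"
    by (simp add: d algebra_simps sum.distrib sum_distrib_left)
  also have "\<dots> = (\<Sum>i\<in>UNIV. p $ i * A x $ i $ l) + (\<Sum>j\<in>UNIV. p $ j * A x $ l $ j)"
    by (simp add: ax cong: if_cong)
  also have "\<dots> = 2 * (A x *v p) $ l"
    by (simp add: matrix_vector_mult_def sym[of _ l] mult.commute)
  finally show "frechet_derivative (quad_fun A) (at (x, p)) (0, axis l 1) = 2 * (A x *v p) $ l" .
qed

text \<open>The Poisson bracket of the Hamiltonian of \<open>G\<close> with the quadratic integral
  of \<open>K\<close>, a cubic form in \<open>p\<close>. The factor 1/2 of the Hamiltonian cancels
  the 2 from differentiating a quadratic form in the momenta.\<close>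

definition killing_form ::
  "(real^'n::finite \<Rightarrow> real^'n^'n) \<Rightarrow> (real^'n \<Rightarrow> real^'n^'n) \<Rightarrow> real^'n \<Rightarrow> real^'n \<Rightarrow> real" where
  "killing_form G K x p =
    (\<Sum>l\<in>UNIV. (G x *v p) $ l * (p \<bullet> (pdm l K x *v p)) - (p \<bullet> (pdm l G x *v p)) * (K x *v p) $ l)"

lemma poisson_quad_fun:
  fixes A B :: "real^'n::finite \<Rightarrow> real^'n^'n"
  assumes "smooth_matrix_field U A" "smooth_matrix_field U B" "x \<in> U"
    and "symmetric_matrix (A x)" "symmetric_matrix (B x)"
  shows "poisson (\<lambda>z. (1/2) * quad_fun A z) (quad_fun B) (x, p) = killing_form A B x p"
proof -
  have "frechet_derivative (\<lambda>z. (1/2) * quad_fun A z) (at (x, p)) v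
      = 1 / 2 * frechet_derivative (quad_fun A) (at (x, p)) v" for v
  proof -
    have "quad_fun A differentiable (at (x, p))"
      using quad_fun_has_derivative[OF assms(1,3)] differentiableI by blast
    then have "((\<lambda>z. (1/2) * quad_fun A z) has_derivative
        (\<lambda>v. 1 / 2 * frechet_derivative (quad_fun A) (at (x, p)) v)) (at (x, p))"
      using frechet_derivative_works has_derivative_mult_right by blast
    from frechet_derivative_at[OF this] show ?thesis
      by metis
  qed
  then show ?thesis
    unfolding poisson_def killing_form_def
    by (simp only: quad_fun_derivative_axis[OF assms(1,3,4)] quad_fun_derivative_axis[OF assms(2,3,5)])
      simp
qed

lemma pdm_lincomb:
  assumes "x \<in> U" "\<And>\<gamma>. \<gamma> \<in> S \<Longrightarrow> smooth_matrix_field U (K \<gamma>)"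
  shows "pdm l (\<lambda>y. \<Sum>\<gamma>\<in>S. e \<gamma> *\<^sub>R K \<gamma> y) x = (\<Sum>\<gamma>\<in>S. e \<gamma> *\<^sub>R pdm l (K \<gamma>) x)"
proof -
  have d: "(\<lambda>y. K \<gamma> y $ i $ j) differentiable (at x)" if "\<gamma> \<in> S" for \<gamma> i j
    using assms that smooth_on_differentiable[of U] unfolding smooth_matrix_field_def by auto
  have "pd l (\<lambda>y. \<Sum>\<gamma>\<in>S. e \<gamma> * K \<gamma> y $ i $ j) x = (\<Sum>\<gamma>\<in>S. e \<gamma> * pd l (\<lambda>y. K \<gamma> y $ i $ j) x)" for i j
    using d by (subst pd_sum) (auto intro!: sum.cong pd_cmult differentiable_mult)
  then show ?thesis
    by (simp add: vec_eq_iff pdm_def sum_component)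
qed

text \<open>The coefficients are constants. Variable ones would add a cubic term built from their
  gradients, and that term is what the later argument extracts.\<close>

lemma killing_form_lincomb:
  assumes "x \<in> U" "\<And>\<gamma>. \<gamma> \<in> S \<Longrightarrow> smooth_matrix_field U (K \<gamma>)"
  shows "killing_form G (\<lambda>y. \<Sum>\<gamma>\<in>S. e \<gamma> *\<^sub>R K \<gamma> y) x p = (\<Sum>\<gamma>\<in>S. e \<gamma> * killing_form G (K \<gamma>) x p)"
proof -
  have pd: "pdm l (\<lambda>y. \<Sum>\<gamma>\<in>S. e \<gamma> *\<^sub>R K \<gamma> y) x = (\<Sum>\<gamma>\<in>S. e \<gamma> *\<^sub>R pdm l (K \<gamma>) x)" for l
    using assms by (rule pdm_lincomb)
  have "killing_form G (\<lambda>y. \<Sum>\<gamma>\<in>S. e \<gamma> *\<^sub>R K \<gamma> y) x p = (\<Sum>l\<in>UNIV. \<Sum>\<gamma>\<in>S. e \<gamma> *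
      ((G x *v p) $ l * (p \<bullet> (pdm l (K \<gamma>) x *v p)) - (p \<bullet> (pdm l G x *v p)) * (K \<gamma> x *v p) $ l))"
    unfolding killing_form_def pd matrix_vector_mult_sum_scaleR
    by (simp add: inner_sum_right sum_component sum_distrib_left sum_subtractf[symmetric] algebra_simps)
  also have "\<dots> = (\<Sum>\<gamma>\<in>S. e \<gamma> * killing_form G (K \<gamma>) x p)"
    unfolding killing_form_def sum_distrib_left by (rule sum.swap)
  finally show ?thesis .
qed

lemma cubic_form_sum:
  "(\<Sum>c\<in>UNIV. \<Sum>i\<in>UNIV. \<Sum>j\<in>UNIV. v $ c * v $ i * v $ j * A c $ i $ j) =
    (\<Sum>c\<in>UNIV. v $ c * (v \<bullet> (A c *v v)))" for A :: "'n::finite \<Rightarrow> real^'n^'n"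
  by (simp add: inner_matrix_vector_sum sum_distrib_left mult.assoc)

lemma cubic_form_sum_product:
  "(\<Sum>c\<in>UNIV. \<Sum>i\<in>UNIV. \<Sum>j\<in>UNIV. v $ c * v $ i * v $ j * (\<Sum>l\<in>UNIV. P l $ c $ i * Q $ l $ j)) =
    (\<Sum>l\<in>UNIV. (v \<bullet> (P l *v v)) * (Q *v v) $ l)" for P :: "'n::finite \<Rightarrow> real^'n^'n"
proof -
  have "(\<Sum>c\<in>UNIV. \<Sum>i\<in>UNIV. \<Sum>j\<in>UNIV. v $ c * v $ i * v $ j * (\<Sum>l\<in>UNIV. P l $ c $ i * Q $ l $ j)) =
      (\<Sum>c\<in>UNIV. \<Sum>i\<in>UNIV. \<Sum>l\<in>UNIV. \<Sum>j\<in>UNIV. v $ c * v $ i * v $ j * (P l $ c $ i * Q $ l $ j))"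
    unfolding sum_distrib_left by (intro sum.cong refl sum.swap)
  also have "\<dots> = (\<Sum>c\<in>UNIV. \<Sum>l\<in>UNIV. \<Sum>i\<in>UNIV. \<Sum>j\<in>UNIV. v $ c * v $ i * v $ j * (P l $ c $ i * Q $ l $ j))"
    by (intro sum.cong refl sum.swap)
  also have "\<dots> = (\<Sum>l\<in>UNIV. \<Sum>c\<in>UNIV. \<Sum>i\<in>UNIV. \<Sum>j\<in>UNIV. v $ c * v $ i * v $ j * (P l $ c $ i * Q $ l $ j))"
    by (rule sum.swap)
  also have "\<dots> = (\<Sum>l\<in>UNIV. (v \<bullet> (P l *v v)) * (Q *v v) $ l)"
    unfolding inner_matrix_vector_sum
    by (simp add: matrix_vector_mult_def sum_distrib_left sum_distrib_right mult_ac)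
  finally show ?thesis .
qed

text \<open>Lowering both indices and substituting p = g v turns the bracket into an equation for
  the fully symmetrized derivative of \<open>k\<close>, the form that the prolongation handles.
  Since \<open>k\<close> is linear in \<open>L\<close> with smooth coefficients, flatness carries
  over, and \<open>G ** k ** G\<close> gives \<open>L\<close> back.\<close>

lemma killing_tensor_unique:
  fixes G g L :: "real^'n::finite \<Rightarrow> real^'n^'n"
  assumes U: "open U" "connected U"
    and smooth: "smooth_matrix_field U G" "smooth_matrix_field U g" "smooth_matrix_field U L"
    and inv: "\<And>x. x \<in> U \<Longrightarrow> G x ** g x = mat 1"
    and sym: "\<And>x. x \<in> U \<Longrightarrow> symmetric_matrix (g x)" "\<And>x. x \<in> U \<Longrightarrow> symmetric_matrix (L x)"
    and killing: "\<And>x p. x \<in> U \<Longrightarrow> killing_form G L x p = 0"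
    and x0: "x0 \<in> U" "\<And>i j. flat 2 (\<lambda>y. L y $ i $ j) x0"
    and x: "x \<in> U"
  shows "L x = 0"
proof -
  define k where "k = (\<lambda>y. g y ** L y ** g y)"
  \<comment> \<open>The first term comes from differentiating the two outer factors of
    \<open>g ** L ** g\<close>, equal as quadratic forms, the second from the position derivative of
    the Hamiltonian. Contracted with v twice, the sum is twice the Christoffel symbol so
    contracted.\<close>
  define M where "M = (\<lambda>c i s y. 2 * (pdm c g y ** G y) $ i $ s
      + (\<Sum>l\<in>UNIV. (g y ** pdm l G y ** g y) $ c $ i * G y $ l $ s))"
  note sm = smooth_matrix_field_mult[OF U(1)] smooth_matrix_field_pdm[OF U(1)]
  have tr: "transpose (g y) = g y" "transpose (L y) = L y" if "y \<in> U" for y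
    using sym that by (simp_all add: symmetric_matrix_def)
  have inv': "g y ** G y = mat 1" if "y \<in> U" for y
    using inv[OF that] matrix_left_right_inverse by blast
  have k_smooth: "smooth_matrix_field U k"
    unfolding k_def by (intro sm smooth)
  have "k x $ i $ j = 0" for i j
  proof (rule killing_jet_unique[of U "\<lambda>i j y. k y $ i $ j" M, OF U _ _ _ _ x0(1) _ x])
    show "smooth_on U (\<lambda>y. k y $ i $ j)" for i j
      using k_smooth by (simp add: smooth_matrix_field_def)
    show "smooth_on U (M c i s)" for c i s
      unfolding M_def
      using sm(1)[OF sm(2)[OF smooth(2)] smooth(1)] sm(1)[OF sm(1)[OF smooth(2) sm(2)[OF smooth(1)]] smooth(2)] smooth(1)
      by (intro smooth_on_add smooth_on_mult smooth_on_sum smooth_on_const U)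
        (auto simp: smooth_matrix_field_def)
    show "k y $ i $ j = k y $ j $ i" if "y \<in> U" for i j y
    proof -
      have "transpose (k y) = k y"
        by (simp add: k_def matrix_transpose_mul tr[OF that] matrix_mul_assoc)
      then show ?thesis
        by (intro symmetric_matrix_nth) (simp add: symmetric_matrix_def)
    qed
    show "flat 2 (\<lambda>y. k y $ i $ j) x0" for i j
    proof -
      have "flat 2 (\<lambda>y. \<Sum>s\<in>UNIV. \<Sum>r\<in>UNIV. L y $ r $ s * (g y $ i $ r * g y $ s $ j)) x0"
        using smooth by (intro flat_sum[OF U(1) x0(1)] flat_mult[OF U(1) x0(1)] smooth_on_sum
            smooth_on_mult U(1) x0(2)) (auto simp: smooth_matrix_field_def)
      then show ?thesis
        by (simp add: k_def matrix_matrix_mult_def sum_distrib_left sum_distrib_right mult_ac)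
    qed
  next
    fix y v assume y: "y \<in> U"
    define p where "p = g y *v v"
    have Gp: "G y *v p = v"
      by (simp add: p_def matrix_vector_mul_assoc inv[OF y])
    have Lg: "L y ** g y = G y ** k y"
      by (simp add: k_def matrix_mul_assoc inv[OF y])
    have Lp: "L y *v p = (G y ** k y) *v v"
      by (simp add: p_def matrix_vector_mul_assoc Lg)
    have pdk: "v \<bullet> (pdm c k y *v v) = 2 * (v \<bullet> ((pdm c g y ** G y ** k y) *v v)) + p \<bullet> (pdm c L y *v p)" for c
    proof -
      have "pdm c k y = pdm c g y ** L y ** g y + g y ** pdm c L y ** g y + g y ** L y ** pdm c g y"
        unfolding k_def
        by (simp add: pdm_mult[OF U(1) y] sm smooth matrix_mul_assoc matrix_add_rdistrib)
      moreover have "v \<bullet> ((g y ** pdm c L y ** g y) *v v) = p \<bullet> (pdm c L y *v p)"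
        using quadratic_form_congruence[of v "g y" "pdm c L y"] by (simp add: tr[OF y] p_def)
      moreover have "v \<bullet> ((g y ** L y ** pdm c g y) *v v) = v \<bullet> ((pdm c g y ** L y ** g y) *v v)"
      proof -
        have "transpose (pdm c g y) = pdm c g y"
        proof -
          have "pd c (\<lambda>y. g y $ i $ j) y = pd c (\<lambda>y. g y $ j $ i) y" for i j
            by (rule pd_cong[OF U(1) y]) (intro symmetric_matrix_nth sym)
          then show ?thesis
            by (simp add: vec_eq_iff pdm_def transpose_def)
        qed
        then have "transpose (pdm c g y ** L y ** g y) = g y ** L y ** pdm c g y"
          by (simp add: matrix_transpose_mul tr[OF y] matrix_mul_assoc)
        then show ?thesis
          by (metis quadratic_form_transpose)
      qed
      moreover have "pdm c g y ** L y ** g y = pdm c g y ** G y ** k y"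
        by (metis Lg matrix_mul_assoc)
      ultimately show ?thesis
        by (simp add: matrix_vector_mult_add_rdistrib inner_add_right)
    qed
    have Mk: "(\<Sum>s\<in>UNIV. M c i s y * k y $ s $ j) = 2 * (pdm c g y ** G y ** k y) $ i $ j
       + (\<Sum>l\<in>UNIV. (g y ** pdm l G y ** g y) $ c $ i * (G y ** k y) $ l $ j)" for c i j
    proof -
      have "(\<Sum>s\<in>UNIV. M c i s y * k y $ s $ j) = 2 * (\<Sum>s\<in>UNIV. (pdm c g y ** G y) $ i $ s * k y $ s $ j)
        + (\<Sum>s\<in>UNIV. \<Sum>l\<in>UNIV. (g y ** pdm l G y ** g y) $ c $ i * (G y $ l $ s * k y $ s $ j))"
        unfolding M_def by (simp add: distrib_right sum.distrib sum_distrib_left sum_distrib_right mult.assoc)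
      also have "(\<Sum>s\<in>UNIV. \<Sum>l\<in>UNIV. (g y ** pdm l G y ** g y) $ c $ i * (G y $ l $ s * k y $ s $ j))
        = (\<Sum>l\<in>UNIV. (g y ** pdm l G y ** g y) $ c $ i * (\<Sum>s\<in>UNIV. G y $ l $ s * k y $ s $ j))"
        unfolding sum_distrib_left by (rule sum.swap)
      finally show ?thesis
        by (simp add: matrix_matrix_mult_def[of _ "k y"])
    qed
    have "(\<Sum>c\<in>UNIV. \<Sum>i\<in>UNIV. \<Sum>j\<in>UNIV. v $ c * v $ i * v $ j *
         (pd c (\<lambda>y. k y $ i $ j) y - (\<Sum>s\<in>UNIV. M c i s y * k y $ s $ j)))
      = (\<Sum>c\<in>UNIV. \<Sum>i\<in>UNIV. \<Sum>j\<in>UNIV. v $ c * v $ i * v $ j * pdm c k y $ i $ j)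
       - 2 * (\<Sum>c\<in>UNIV. \<Sum>i\<in>UNIV. \<Sum>j\<in>UNIV. v $ c * v $ i * v $ j * (pdm c g y ** G y ** k y) $ i $ j)
       - (\<Sum>c\<in>UNIV. \<Sum>i\<in>UNIV. \<Sum>j\<in>UNIV. v $ c * v $ i * v $ j *
           (\<Sum>l\<in>UNIV. (g y ** pdm l G y ** g y) $ c $ i * (G y ** k y) $ l $ j))"
      unfolding Mk sum_distrib_left[of 2] sum_subtractf[symmetric]
      by (intro sum.cong refl) (simp add: pdm_def right_diff_distrib distrib_left)
    also have "\<dots> = (\<Sum>c\<in>UNIV. v $ c * (v \<bullet> (pdm c k y *v v)))
       - 2 * (\<Sum>c\<in>UNIV. v $ c * (v \<bullet> ((pdm c g y ** G y ** k y) *v v)))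
       - (\<Sum>l\<in>UNIV. (v \<bullet> ((g y ** pdm l G y ** g y) *v v)) * ((G y ** k y) *v v) $ l)"
      by (simp only: cubic_form_sum cubic_form_sum_product)
    also have "\<dots> = (\<Sum>l\<in>UNIV. v $ l * (p \<bullet> (pdm l L y *v p)))
       - (\<Sum>l\<in>UNIV. (v \<bullet> ((g y ** pdm l G y ** g y) *v v)) * (L y *v p) $ l)"
      by (simp add: pdk Lp distrib_left sum.distrib sum_distrib_left mult_ac)
    also have "\<dots> = (\<Sum>l\<in>UNIV. (G y *v p) $ l * (p \<bullet> (pdm l L y *v p)))
       - (\<Sum>l\<in>UNIV. (p \<bullet> (pdm l G y *v p)) * (L y *v p) $ l)"
      using quadratic_form_congruence[of v "g y", folded p_def] by (simp add: tr[OF y] Gp)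
    also have "\<dots> = 0"
      using killing[OF y, of p] by (simp add: killing_form_def sum_subtractf)
    finally show "(\<Sum>c\<in>UNIV. \<Sum>i\<in>UNIV. \<Sum>j\<in>UNIV. v $ c * v $ i * v $ j *
         (pd c (\<lambda>y. k y $ i $ j) y - (\<Sum>s\<in>UNIV. M c i s y * k y $ s $ j))) = 0" .
  qed
  then have "k x = 0"
    by (simp add: vec_eq_iff)
  moreover have "L x = G x ** k x ** G x"
    unfolding k_def using inv[OF x] inv'[OF x]
    by (metis matrix_mul_assoc matrix_mul_lid matrix_mul_rid)
  ultimately show ?thesis
    by (simp add: vec_eq_iff matrix_matrix_mult_def)
qed

subsection \<open>Linear dependence of the Killing tensors\<close>

lemma matrix_congruence_sum:
  fixes K :: "'a \<Rightarrow> real^'n^'n" and Q :: "real^'n^'m"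
  shows "(\<Sum>\<alpha>\<in>A. c \<alpha> *\<^sub>R (Q ** K \<alpha> ** transpose Q)) = Q ** (\<Sum>\<alpha>\<in>A. c \<alpha> *\<^sub>R K \<alpha>) ** transpose Q"
proof (induction A rule: infinite_finite_induct)
  case (insert a A)
  have "c a *\<^sub>R (Q ** K a ** transpose Q) = Q ** (c a *\<^sub>R K a) ** transpose Q"
    by (simp add: matrix_scalar_ac(1) scalar_matrix_assoc)
  with insert show ?case
    by (simp add: matrix_add_ldistrib matrix_add_rdistrib)
qed (simp_all add: vec_eq_iff matrix_matrix_mult_def)

lemma invertible_congruence_eq_0:
  fixes Q X :: "real^'n^'n"
  assumes "invertible Q" "Q ** X ** transpose Q = 0"
  shows "X = 0"
proof -
  obtain R where R: "R ** Q = mat 1" "Q ** R = mat 1"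
    using assms(1) unfolding invertible_def by blast
  have "transpose Q ** transpose R = mat 1"
    using R(1) by (metis matrix_transpose_mul transpose_mat)
  have "X = R ** Q ** X ** (transpose Q ** transpose R)"
    using R(1) \<open>transpose Q ** transpose R = mat 1\<close> by simp
  also have "\<dots> = R ** (Q ** X ** transpose Q) ** transpose R"
    by (simp add: matrix_mul_assoc)
  also have "\<dots> = 0"
    unfolding assms(2) by (simp add: vec_eq_iff matrix_matrix_mult_def)
  finally show ?thesis .
qed

lemma diagonal_quadratic_form:
  "diagonal_matrix A \<Longrightarrow> q \<bullet> (A *v q) = (\<Sum>i\<in>UNIV. A $ i $ i * (q $ i * q $ i))"
proof -
  assume "diagonal_matrix A"
  then have "q $ i * q $ j * A $ i $ j = (if j = i then A $ i $ i * (q $ i * q $ i) else 0)" for i j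
    by (auto simp: diagonal_matrix_def)
  then show ?thesis
    by (simp add: inner_matrix_vector_sum)
qed

text \<open>In a diagonalizing frame the relation says that \<open>\<Sum>i j. s i j * q i ^ 2 * q j\<close> vanishes
  identically, and the monomials in this cubic form are pairwise distinct.\<close>

lemma diagonal_gradients_zero:
  fixes K :: "'a \<Rightarrow> real^'n^'n" and w :: "'a \<Rightarrow> real^'n" and G Q :: "real^'n^'n"
  assumes Q: "invertible Q" "\<And>\<alpha>. \<alpha> \<in> A \<Longrightarrow> diagonal_matrix (Q ** K \<alpha> ** transpose Q)"
    and indep: "\<And>c. (\<Sum>\<alpha>\<in>A. c \<alpha> *\<^sub>R K \<alpha>) = 0 \<Longrightarrow> \<forall>\<alpha>\<in>A. c \<alpha> = 0"
    and G: "invertible G"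
    and rel: "\<And>p. (\<Sum>\<alpha>\<in>A. (w \<alpha> \<bullet> (G *v p)) * (p \<bullet> (K \<alpha> *v p))) = 0"
    and \<alpha>: "\<alpha> \<in> A"
  shows "w \<alpha> = 0"
proof -
  note [simp del] = transpose_matrix_vector
  let ?e = "\<lambda>i. axis i (1::real) :: real^'n"
  define L where "L = (\<lambda>\<alpha> q. w \<alpha> \<bullet> (G *v (transpose Q *v q)))"
  define \<kappa> where "\<kappa> = (\<lambda>\<alpha> i. (Q ** K \<alpha> ** transpose Q) $ i $ i)"
  define s where "s = (\<lambda>i j. \<Sum>\<alpha>\<in>A. \<kappa> \<alpha> i * L \<alpha> (?e j))"
  have L_lin: "L \<alpha> (t *\<^sub>R u + r *\<^sub>R v) = t * L \<alpha> u + r * L \<alpha> v" for \<alpha> t u r v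
    by (simp add: L_def matrix_vector_right_distrib matrix_vector_mult_scaleR inner_add_right)
  have rel': "(\<Sum>\<alpha>\<in>A. L \<alpha> q * (\<Sum>i\<in>UNIV. \<kappa> \<alpha> i * (q $ i * q $ i))) = 0" for q
  proof -
    have "(\<Sum>\<alpha>\<in>A. L \<alpha> q * (\<Sum>i\<in>UNIV. \<kappa> \<alpha> i * (q $ i * q $ i))) =
        (\<Sum>\<alpha>\<in>A. L \<alpha> q * (q \<bullet> ((Q ** K \<alpha> ** transpose Q) *v q)))"
      by (intro sum.cong refl) (simp add: diagonal_quadratic_form Q(2) \<kappa>_def)
    then show ?thesis
      using rel[of "transpose Q *v q"] quadratic_form_congruence[of q "transpose Q"]
      by (simp add: L_def)
  qed
  \<comment> \<open>Evaluation on the plane of two coordinate axes, with p =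
    \<open>transpose Q *v q\<close>, involves only the coefficients with indices \<open>i\<close>
    and \<open>j\<close>.\<close>
  have cubic: "t * t * t * s i i + t * t * r * s i j + t * r * r * s j i + r * r * r * s j j = 0"
    if "i \<noteq> j" for i j t r
  proof -
    have "(\<Sum>l\<in>UNIV. \<kappa> \<alpha> l * ((t *\<^sub>R ?e i + r *\<^sub>R ?e j) $ l * (t *\<^sub>R ?e i + r *\<^sub>R ?e j) $ l))
        = t * t * \<kappa> \<alpha> i + r * r * \<kappa> \<alpha> j" for \<alpha>
    proof -
      have "\<kappa> \<alpha> l * ((t *\<^sub>R ?e i + r *\<^sub>R ?e j) $ l * (t *\<^sub>R ?e i + r *\<^sub>R ?e j) $ l)
          = (if l = i then t * t * \<kappa> \<alpha> i else 0) + (if l = j then r * r * \<kappa> \<alpha> j else 0)" for l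
        using that by (auto simp: axis_def)
      then show ?thesis
        by (simp add: sum.distrib)
    qed
    then show ?thesis
      using rel'[of "t *\<^sub>R ?e i + r *\<^sub>R ?e j"]
      by (simp add: L_lin s_def sum_distrib_left sum.distrib algebra_simps)
  qed
  have s_diag: "s i i = 0" for i
  proof -
    have "(\<Sum>l\<in>UNIV. \<kappa> \<alpha> l * (?e i $ l * ?e i $ l)) = \<kappa> \<alpha> i" for \<alpha>
      by (simp add: axis_def if_distrib[where f = "\<lambda>c. _ * c"] cong: if_cong)
    then show ?thesis
      using rel'[of "?e i"] by (simp add: s_def mult.commute)
  qed
  \<comment> \<open>With the pure cubes gone, r = 1 and r = -1 give the sum and the difference of
    the two mixed coefficients.\<close>
  have s_zero: "s i j = 0" for i j
  proof (cases "i = j")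
    case False
    then show ?thesis
      using cubic[of i j 1 1] cubic[of i j 1 "-1"] s_diag by simp
  qed (use s_diag in simp)
  have "L \<alpha> (?e j) = 0" for j
  proof -
    \<comment> \<open>For fixed \<open>j\<close>, the numbers \<open>s i j\<close> are the diagonal
      entries of this combination in the frame, where it has no other entries.\<close>
    have "(\<Sum>\<alpha>\<in>A. L \<alpha> (?e j) *\<^sub>R (Q ** K \<alpha> ** transpose Q)) $ i $ l = 0" for i l
    proof (cases "i = l")
      case True
      then show ?thesis
        using s_zero[of i j] by (simp add: sum_component s_def \<kappa>_def mult.commute)
    next
      case False
      then show ?thesis
        using Q(2) by (auto simp: sum_component diagonal_matrix_def intro!: sum.neutral)
    qed
    then have "Q ** (\<Sum>\<alpha>\<in>A. L \<alpha> (?e j) *\<^sub>R K \<alpha>) ** transpose Q = 0"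
      by (simp add: matrix_congruence_sum[symmetric] vec_eq_iff)
    then show ?thesis
      using indep[of "\<lambda>\<alpha>. L \<alpha> (?e j)"] invertible_congruence_eq_0[OF Q(1)] \<alpha> by blast
  qed
  then have "(transpose (G ** transpose Q) *v w \<alpha>) $ j = 0" for j
    by (simp add: L_def matrix_vector_mul_assoc inner_transpose_matrix_vector[symmetric] inner_axis)
  then have "transpose (G ** transpose Q) *v w \<alpha> = 0"
    by (simp add: vec_eq_iff)
  moreover have "invertible (transpose (G ** transpose Q))"
    using G Q(1) by (simp add: invertible_det_nz det_mul)
  ultimately show ?thesis
    by (metis invertible_def matrix_vector_mul_assoc matrix_vector_mul_lid matrix_vector_mult_0_right)
qed

text \<open>Padding by the identity outside \<open>A\<close> keeps the matrix square over the fixed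
  index type, so determinants and Cramer's rule serve every subset \<open>A\<close> at once.\<close>

definition gram :: "'n::finite set \<Rightarrow> ('n \<Rightarrow> 'v::real_inner) \<Rightarrow> real^'n^'n" where
  "gram A X = (\<chi> i j. if i \<in> A \<and> j \<in> A then X i \<bullet> X j else if i = j then 1 else 0)"

lemma gram_vector_mult:
  "(gram A X *v c) $ i = (if i \<in> A then X i \<bullet> (\<Sum>j\<in>A. c $ j *\<^sub>R X j) else c $ i)"
proof (cases "i \<in> A")
  case True
  then have "(gram A X *v c) $ i = (\<Sum>j\<in>UNIV. if j \<in> A then c $ j * (X i \<bullet> X j) else 0)"
    by (auto simp: matrix_vector_mult_def gram_def intro!: sum.cong)
  then show ?thesis
    using True by (simp add: inner_sum_right sum.If_cases)
next
  case False
  then show ?thesis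
    by (simp add: matrix_vector_mult_def gram_def if_distrib[where f = "\<lambda>c. c * _"] cong: if_cong)
qed

text \<open>A kernel vector gives a combination of the \<open>X i\<close> that is orthogonal to each
  of them, hence to itself.\<close>

lemma det_gram_nonzero:
  assumes "\<And>c. (\<Sum>\<alpha>\<in>A. c \<alpha> *\<^sub>R X \<alpha>) = 0 \<Longrightarrow> \<forall>\<alpha>\<in>A. c \<alpha> = 0"
  shows "det (gram A X) \<noteq> 0"
proof -
  have "c = 0" if c: "gram A X *v c = 0" for c
  proof -
    define Y where "Y = (\<Sum>j\<in>A. c $ j *\<^sub>R X j)"
    have *: "(gram A X *v c) $ i = 0" for i
      using c by simp
    have "X i \<bullet> Y = 0" if "i \<in> A" for i
      using *[of i] that unfolding gram_vector_mult Y_def by simp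
    then have "Y \<bullet> Y = 0"
      by (subst (1) Y_def) (simp add: inner_sum_left)
    then have "\<forall>\<alpha>\<in>A. c $ \<alpha> = 0"
      using assms[of "\<lambda>j. c $ j"] by (simp add: Y_def)
    moreover have "c $ i = 0" if "i \<notin> A" for i
      using *[of i] that by (simp add: gram_vector_mult)
    ultimately show ?thesis
      by (auto simp: vec_eq_iff)
  qed
  then have "\<exists>B. B ** gram A X = mat 1"
    by (simp add: matrix_left_invertible_ker)
  then show ?thesis
    using invertible_det_nz invertible_left_inverse by blast
qed

text \<open>Cramer's quotient for the normal equations of \<open>Y\<close> against the family
  \<open>X\<close>. It makes sense also when \<open>Y\<close> is outside the span, which extends the
  coefficients beyond the set where the relation holds.\<close>

definition gram_coeff :: "'n::finite set \<Rightarrow> ('n \<Rightarrow> 'v::real_inner) \<Rightarrow> 'v \<Rightarrow> 'n \<Rightarrow> real" where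
  "gram_coeff A X Y \<alpha> = det (\<chi> i j. if j = \<alpha> then if i \<in> A then X i \<bullet> Y else 0 else gram A X $ i $ j)
     / det (gram A X)"

lemma gram_coeff_eq:
  assumes "det (gram A X) \<noteq> 0" "Y = (\<Sum>j\<in>A. c j *\<^sub>R X j)" "\<alpha> \<in> A"
  shows "gram_coeff A X Y \<alpha> = c \<alpha>"
proof -
  let ?c = "\<chi> j. if j \<in> A then c j else 0"
  let ?b = "\<chi> i. if i \<in> A then X i \<bullet> Y else 0"
  have "(\<Sum>j\<in>A. ?c $ j *\<^sub>R X j) = Y"
    unfolding assms(2) by (intro sum.cong) auto
  then have "gram A X *v ?c = ?b"
    by (simp add: vec_eq_iff gram_vector_mult)
  then have "?c = (\<chi> k. det (\<chi> i j. if j = k then ?b $ i else gram A X $ i $ j) / det (gram A X))"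
    using cramer[OF assms(1)] by blast
  then have "?c $ \<alpha> = gram_coeff A X Y \<alpha>"
    by (simp add: gram_coeff_def vec_eq_iff cong: if_cong)
  then show ?thesis
    using assms(3) by simp
qed

section \<open>Smooth dependence of the Cramer coefficients on the point\<close>

lemma smooth_on_inner_matrix:
  assumes "open U" "smooth_matrix_field U A" "smooth_matrix_field U B"
  shows "smooth_on U (\<lambda>x. A x \<bullet> B x)"
  using assms unfolding inner_vec_def smooth_matrix_field_def inner_real_def
  by (intro smooth_on_sum smooth_on_mult) auto

lemma smooth_on_gram:
  assumes "open U" "\<And>\<alpha>. smooth_matrix_field U (K \<alpha>)"
  shows "smooth_on U (\<lambda>x. gram A (\<lambda>\<alpha>. K \<alpha> x) $ i $ j)"
  using assms by (cases "i \<in> A \<and> j \<in> A") (auto simp: gram_def smooth_on_inner_matrix smooth_on_const)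

lemma smooth_on_gram_coeff:
  assumes "open U" "\<And>\<alpha>. smooth_matrix_field U (K \<alpha>)" "smooth_matrix_field U B"
    and "\<And>x. x \<in> U \<Longrightarrow> det (gram A (\<lambda>\<alpha>. K \<alpha> x)) \<noteq> 0"
  shows "smooth_on U (\<lambda>x. gram_coeff A (\<lambda>\<alpha>. K \<alpha> x) (B x) \<alpha>)"
  unfolding gram_coeff_def
proof (intro smooth_on_divide smooth_on_det assms)
  fix i j
  show "smooth_on U (\<lambda>x. (\<chi> i j. if j = \<alpha> then if i \<in> A then K i x \<bullet> B x else 0
      else gram A (\<lambda>\<alpha>. K \<alpha> x) $ i $ j) $ i $ j)"
    using assms by (cases "j = \<alpha>"; cases "i \<in> A") (auto simp: smooth_on_inner_matrix smooth_on_const smooth_on_gram)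
  show "smooth_on U (\<lambda>x. gram A (\<lambda>\<alpha>. K \<alpha> x) $ i $ j)"
    using assms(1,2) by (rule smooth_on_gram)
qed

lemma negligible_finite_UN:
  "finite I \<Longrightarrow> (\<And>i. i \<in> I \<Longrightarrow> negligible (S i)) \<Longrightarrow> negligible (\<Union>i\<in>I. S i)"
  by (intro negligible_Union) auto

text \<open>In a dependent index set of least cardinality, deleting an index with nonzero
  coefficient leaves an independent family, and the relation can be solved for the deleted
  element.\<close>

lemma exists_independent_subset_spanning_element:
  fixes X :: "'n::finite \<Rightarrow> 'v::real_vector"
  assumes "(\<Sum>\<alpha>\<in>UNIV. c \<alpha> *\<^sub>R X \<alpha>) = 0" "c \<alpha>0 \<noteq> 0"
  shows "\<exists>A \<beta>. \<beta> \<notin> A \<and> (\<forall>c. (\<Sum>\<alpha>\<in>A. c \<alpha> *\<^sub>R X \<alpha>) = 0 \<longrightarrow> (\<forall>\<alpha>\<in>A. c \<alpha> = 0)) \<and>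
     (\<exists>c. X \<beta> = (\<Sum>\<alpha>\<in>A. c \<alpha> *\<^sub>R X \<alpha>))"
proof -
  define P where "P = (\<lambda>B. \<exists>c. (\<Sum>\<alpha>\<in>B. c \<alpha> *\<^sub>R X \<alpha>) = 0 \<and> (\<exists>\<alpha>\<in>B. c \<alpha> \<noteq> 0))"
  have "P UNIV"
    unfolding P_def using assms by (intro exI[of _ c]) auto
  then obtain B where B: "P B" "\<And>C. P C \<Longrightarrow> card B \<le> card C"
    using ex_has_least_nat[of P UNIV card] by metis
  obtain d \<beta> where d: "(\<Sum>\<alpha>\<in>B. d \<alpha> *\<^sub>R X \<alpha>) = 0" "\<beta> \<in> B" "d \<beta> \<noteq> 0"
    using B(1) unfolding P_def by blast
  let ?A = "B - {\<beta>}"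
  have "card ?A < card B"
    using d(2) by (intro card_Diff1_less) simp_all
  then have "\<not> P ?A"
    using B(2)[of ?A] by linarith
  then have indep: "\<forall>c. (\<Sum>\<alpha>\<in>?A. c \<alpha> *\<^sub>R X \<alpha>) = 0 \<longrightarrow> (\<forall>\<alpha>\<in>?A. c \<alpha> = 0)"
    unfolding P_def by blast
  have X\<beta>: "X \<beta> = (\<Sum>\<alpha>\<in>?A. (- d \<alpha> / d \<beta>) *\<^sub>R X \<alpha>)"
  proof -
    have "d \<beta> *\<^sub>R X \<beta> = - (\<Sum>\<alpha>\<in>?A. d \<alpha> *\<^sub>R X \<alpha>)"
      using d(1) by (simp add: sum.remove[OF _ d(2)] add_eq_0_iff2)
    then have "(1 / d \<beta>) *\<^sub>R (d \<beta> *\<^sub>R X \<beta>) = (1 / d \<beta>) *\<^sub>R - (\<Sum>\<alpha>\<in>?A. d \<alpha> *\<^sub>R X \<alpha>)"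
      by simp
    then show ?thesis
      using d(3) by (simp add: scaleR_sum_right sum_negf)
  qed
  show ?thesis
  proof (intro exI conjI)
    show "\<beta> \<notin> ?A"
      by simp
  qed (rule indep, rule X\<beta>)
qed

text \<open>\<open>no_relation\<close> is the form in which functional independence enters: no
  relation with constant coefficients holds on all of \<open>U\<close>.\<close>

locale killing_family =
  fixes U :: "(real^'n::finite) set"
    and G g :: "real^'n \<Rightarrow> real^'n^'n"
    and K :: "'n \<Rightarrow> real^'n \<Rightarrow> real^'n^'n"
  assumes open_U: "open U" and connected_U: "connected U"
    and smooth_G: "smooth_matrix_field U G"
    and smooth_g: "smooth_matrix_field U g"
    and smooth_K: "\<And>\<alpha>. smooth_matrix_field U (K \<alpha>)"
    and G_g: "\<And>x. x \<in> U \<Longrightarrow> G x ** g x = mat 1"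
    and sym_g: "\<And>x. x \<in> U \<Longrightarrow> symmetric_matrix (g x)"
    and sym_K: "\<And>\<alpha> x. x \<in> U \<Longrightarrow> symmetric_matrix (K \<alpha> x)"
    and killing_K: "\<And>\<alpha> x p. x \<in> U \<Longrightarrow> killing_form G (K \<alpha>) x p = 0"
    and no_relation: "\<And>c. (\<And>x. x \<in> U \<Longrightarrow> (\<Sum>\<alpha>\<in>UNIV. c \<alpha> *\<^sub>R K \<alpha> x) = 0) \<Longrightarrow> (\<And>\<alpha>. c \<alpha> = 0)"
begin

text \<open>A combination with constant coefficients is again Killing, so its vanishing 2-jet at one
  point would spread over \<open>U\<close> and contradict \<open>no_relation\<close>.\<close>

lemma not_flat_lincomb:
  assumes x0: "x0 \<in> U" and c: "c \<beta> \<noteq> 0"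
    and flat: "\<And>i j. flat 2 (\<lambda>y. (\<Sum>\<alpha>\<in>UNIV. c \<alpha> *\<^sub>R K \<alpha> y) $ i $ j) x0"
  shows False
proof -
  define L where "L = (\<lambda>y. \<Sum>\<alpha>\<in>UNIV. c \<alpha> *\<^sub>R K \<alpha> y)"
  have "smooth_matrix_field U L"
    using smooth_K unfolding L_def smooth_matrix_field_def
    by (auto simp: sum_component intro!: smooth_on_sum smooth_on_mult smooth_on_const open_U)
  moreover have "symmetric_matrix (L x)" if "x \<in> U" for x
    unfolding symmetric_matrix_def
    by (simp add: vec_eq_iff transpose_def L_def sum_component symmetric_matrix_nth[OF sym_K[OF that]])
  moreover have "killing_form G L x p = 0" if "x \<in> U" for x p
    unfolding L_def using that by (simp add: killing_form_lincomb[OF that smooth_K] killing_K)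
  ultimately have "L x = 0" if "x \<in> U" for x
    using killing_tensor_unique[OF open_U connected_U smooth_G smooth_g _ G_g sym_g _ _ x0 _ that, of L] flat
    by (simp add: L_def)
  then show False
    using no_relation[of c] c by (auto simp: L_def)
qed

text \<open>On \<open>E\<close> the coefficients of the relation are given by Cramer's rule, hence are smooth near \<open>E\<close>.
  At almost every point of \<open>E\<close> all functions vanishing on \<open>E\<close> are flat; there the Killing equation
  forces the coefficients to have zero gradient. Then also the gradients are flat almost everywhere
  on \<open>E\<close>, so freezing the coefficients gives a Killing tensor with vanishing \<open>2\<close>-jet.\<close>

lemma negligible_dependent_set:
  assumes \<beta>: "\<beta> \<notin> A"
    and E: "\<And>x. x \<in> E \<Longrightarrow> x \<in> U"
      "\<And>x. x \<in> E \<Longrightarrow> \<exists>Q :: real^'n^'n. invertible Q \<and> (\<forall>\<alpha>. diagonal_matrix (Q ** K \<alpha> x ** transpose Q))"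
      "\<And>x c \<alpha>. x \<in> E \<Longrightarrow> (\<Sum>\<alpha>\<in>A. c \<alpha> *\<^sub>R K \<alpha> x) = 0 \<Longrightarrow> \<alpha> \<in> A \<Longrightarrow> c \<alpha> = 0"
      "\<And>x. x \<in> E \<Longrightarrow> \<exists>c. K \<beta> x = (\<Sum>\<alpha>\<in>A. c \<alpha> *\<^sub>R K \<alpha> x)"
  shows "negligible E"
proof -
  define V where "V = {x \<in> U. det (gram A (\<lambda>\<alpha>. K \<alpha> x)) \<noteq> 0}"
  define f where "f = (\<lambda>\<alpha> x. gram_coeff A (\<lambda>\<alpha>. K \<alpha> x) (K \<beta> x) \<alpha>)"
  define \<Phi> where "\<Phi> = (\<lambda>i j x. K \<beta> x $ i $ j - (\<Sum>\<alpha>\<in>A. f \<alpha> x * K \<alpha> x $ i $ j))"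
  have "continuous_on U (\<lambda>x. det (gram A (\<lambda>\<alpha>. K \<alpha> x)))"
    by (intro smooth_on_continuous_on smooth_on_det smooth_on_gram open_U smooth_K)
  then have "open (U \<inter> (\<lambda>x. det (gram A (\<lambda>\<alpha>. K \<alpha> x))) -` (- {0}))"
    using continuous_open_preimage[OF _ open_U] by blast
  moreover have "U \<inter> (\<lambda>x. det (gram A (\<lambda>\<alpha>. K \<alpha> x))) -` (- {0}) = V"
    by (auto simp: V_def)
  ultimately have V: "open V"
    by simp
  have VU: "V \<subseteq> U"
    by (auto simp: V_def)
  have KV: "smooth_on V (\<lambda>x. K \<alpha> x $ i $ j)" for \<alpha> i j
    using smooth_K VU smooth_on_subset unfolding smooth_matrix_field_def by blast
  have f_smooth: "smooth_on V (f \<alpha>)" for \<alpha>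
    unfolding f_def using V KV by (intro smooth_on_gram_coeff) (auto simp: smooth_matrix_field_def V_def)
  have \<Phi>_smooth: "smooth_on V (\<Phi> i j)" for i j
    unfolding \<Phi>_def by (intro smooth_on_diff smooth_on_sum smooth_on_mult V KV f_smooth)
  have EV: "x \<in> V" if "x \<in> E" for x
    using E(1)[OF that] det_gram_nonzero[where A = A and X = "\<lambda>\<alpha>. K \<alpha> x"] E(3)[OF that] by (auto simp: V_def)
  have \<Phi>_zero: "\<Phi> i j x = 0" if "x \<in> E" for i j x
  proof -
    obtain c where c: "K \<beta> x = (\<Sum>\<alpha>\<in>A. c \<alpha> *\<^sub>R K \<alpha> x)"
      using E(4)[OF \<open>x \<in> E\<close>] by blast
    have "f \<alpha> x = c \<alpha>" if "\<alpha> \<in> A" for \<alpha>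
      unfolding f_def using EV[OF \<open>x \<in> E\<close>] c that by (intro gram_coeff_eq) (auto simp: V_def)
    then show ?thesis
      by (simp add: \<Phi>_def c sum_component)
  qed
  \<comment> \<open>The orders match: a gradient flat to order 1 makes
    \<open>f \<alpha> - f \<alpha> x\<close> flat to order 2, as required of \<Phi> too.\<close>
  define N where "N = (\<Union>i. \<Union>j. {x \<in> V. \<Phi> i j x = 0 \<and> \<not> flat 2 (\<Phi> i j) x})
    \<union> (\<Union>\<alpha>. \<Union>i. {x \<in> V. pd i (f \<alpha>) x = 0 \<and> \<not> flat 1 (pd i (f \<alpha>)) x})"
  have "negligible N"
  proof -
    have "negligible {x \<in> V. \<Phi> i j x = 0 \<and> \<not> flat 2 (\<Phi> i j) x}" for i j
      using V \<Phi>_smooth by (rule negligible_zeros_not_flat)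
    moreover have "negligible {x \<in> V. pd i (f \<alpha>) x = 0 \<and> \<not> flat 1 (pd i (f \<alpha>)) x}" for \<alpha> i
      using V smooth_on_pd[OF V f_smooth] by (rule negligible_zeros_not_flat)
    ultimately show ?thesis
      unfolding N_def by (intro negligible_Un negligible_finite_UN finite) simp_all
  qed
  moreover have "E \<subseteq> N"
  proof (rule subsetI, rule ccontr)
    fix x assume x: "x \<in> E" "x \<notin> N"
    note xV = EV[OF x(1)]
    note xU = E(1)[OF x(1)]
    have \<Phi>_flat: "flat 2 (\<Phi> i j) x" for i j
      using x(2) xV \<Phi>_zero[OF x(1), of i j] by (auto simp: N_def simp del: flat.simps)
    \<comment> \<open>The relation frozen at \<open>x\<close>; the coefficient 1 at \<beta> makes it
      nontrivial.\<close>
    define c where "c = (\<lambda>\<alpha>. if \<alpha> = \<beta> then 1 else if \<alpha> \<in> A then - f \<alpha> x else 0)"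
    define L where "L = (\<lambda>y. \<Sum>\<alpha>\<in>UNIV. c \<alpha> *\<^sub>R K \<alpha> y)"
    define w where "w = (\<lambda>\<alpha>. \<chi> l. pd l (f \<alpha>) x)"
    \<comment> \<open>The error of the relation with variable coefficients, plus the cost of
      freezing them.\<close>
    have L: "L y $ i $ j = \<Phi> i j y + (\<Sum>\<alpha>\<in>A. (f \<alpha> y - f \<alpha> x) * K \<alpha> y $ i $ j)" for y i j
    proof -
      have "L y $ i $ j = (\<Sum>\<alpha>\<in>UNIV. (if \<alpha> = \<beta> then K \<alpha> y $ i $ j else 0)
          + (if \<alpha> \<in> A then - f \<alpha> x * K \<alpha> y $ i $ j else 0))"
        unfolding L_def sum_component c_def using \<beta> by (intro sum.cong) auto
      also have "\<dots> = K \<beta> y $ i $ j + (\<Sum>\<alpha>\<in>A. - f \<alpha> x * K \<alpha> y $ i $ j)"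
        by (simp add: sum.distrib sum.If_cases)
      finally show ?thesis
        by (simp add: \<Phi>_def left_diff_distrib sum_subtractf sum_negf)
    qed
    have L_zero: "L x = 0"
      by (simp add: vec_eq_iff L \<Phi>_zero[OF x(1)])
    have pdL: "pdm l L x = (\<Sum>\<alpha>\<in>A. w \<alpha> $ l *\<^sub>R K \<alpha> x)" for l
    proof -
      have d: "\<Phi> i j differentiable (at x)" "f \<alpha> differentiable (at x)" "(\<lambda>y. K \<alpha> y $ i $ j) differentiable (at x)" for i j \<alpha>
        using smooth_on_differentiable xV \<Phi>_smooth f_smooth KV by blast+
      have "pd l (\<lambda>y. f \<alpha> y - f \<alpha> x) x = pd l (f \<alpha>) x" for \<alpha>
        using pd_diff[OF d(2)[of \<alpha>], of "\<lambda>_. f \<alpha> x" l] by simp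
      then have "pd l (\<lambda>y. (f \<alpha> y - f \<alpha> x) * K \<alpha> y $ i $ j) x = pd l (f \<alpha>) x * K \<alpha> x $ i $ j" for \<alpha> i j
        using pd_mult[of "\<lambda>y. f \<alpha> y - f \<alpha> x" x "\<lambda>y. K \<alpha> y $ i $ j" l] d by simp
      then have "pd l (\<lambda>y. L y $ i $ j) x = pd l (\<Phi> i j) x + (\<Sum>\<alpha>\<in>A. pd l (f \<alpha>) x * K \<alpha> x $ i $ j)" for i j
        unfolding L by (simp add: pd_add pd_sum d differentiable_sum)
      moreover have "pd l (\<Phi> i j) x = 0" for i j
        using \<Phi>_flat[of i j] by (simp add: numeral_2_eq_2)
      ultimately show ?thesis
        by (simp add: vec_eq_iff pdm_def sum_component w_def)
    qed
    obtain Q :: "real^'n^'n" where Q: "invertible Q" "\<And>\<alpha>. diagonal_matrix (Q ** K \<alpha> x ** transpose Q)"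
      using E(2)[OF x(1)] by blast
    have G: "invertible (G x)"
      using G_g[OF xU] invertible_right_inverse by blast
    \<comment> \<open>Since \<open>L x = 0\<close>, only the derivatives of \<open>L\<close> survive
      in the Killing form, and by \<open>pdL\<close> these consist of the gradients of the
      coefficients.\<close>
    have rel: "(\<Sum>\<alpha>\<in>A. (w \<alpha> \<bullet> (G x *v p)) * (p \<bullet> (K \<alpha> x *v p))) = 0" for p
    proof -
      have "(\<Sum>l\<in>UNIV. (G x *v p) $ l * (p \<bullet> (pdm l L x *v p))) = killing_form G L x p"
        by (simp add: killing_form_def L_zero)
      also have "\<dots> = 0"
        unfolding L_def by (simp add: killing_form_lincomb[OF xU smooth_K] killing_K[OF xU])
      finally have "0 = (\<Sum>l\<in>UNIV. (G x *v p) $ l * (\<Sum>\<alpha>\<in>A. w \<alpha> $ l * (p \<bullet> (K \<alpha> x *v p))))"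
        by (simp add: pdL matrix_vector_mult_sum_scaleR inner_sum_right)
      also have "\<dots> = (\<Sum>\<alpha>\<in>A. \<Sum>l\<in>UNIV. (G x *v p) $ l * (w \<alpha> $ l * (p \<bullet> (K \<alpha> x *v p))))"
        unfolding sum_distrib_left by (rule sum.swap)
      also have "\<dots> = (\<Sum>\<alpha>\<in>A. (w \<alpha> \<bullet> (G x *v p)) * (p \<bullet> (K \<alpha> x *v p)))"
        by (simp add: inner_vec_def[of "w \<alpha>" for \<alpha>] sum_distrib_left mult_ac)
      finally show ?thesis by simp
    qed
    have "w \<alpha> = 0" if "\<alpha> \<in> A" for \<alpha>
      using diagonal_gradients_zero[of Q A "\<lambda>\<alpha>. K \<alpha> x" "G x" w, OF Q(1) Q(2) _ G rel that] E(3)[OF x(1)] by blast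
    then have "pd l (f \<alpha>) x = 0" if "\<alpha> \<in> A" for \<alpha> l
      using that by (simp add: w_def vec_eq_iff)
    then have pdf_flat: "flat 1 (pd l (f \<alpha>)) x" if "\<alpha> \<in> A" for \<alpha> l
      using that x(2) xV by (auto simp: N_def simp del: flat.simps)
    have f_flat: "flat 2 (\<lambda>y. f \<alpha> y - f \<alpha> x) x" if "\<alpha> \<in> A" for \<alpha>
    proof -
      have "pd l (\<lambda>y. f \<alpha> y - f \<alpha> x) y = pd l (f \<alpha>) y" if "y \<in> V" for l y
        using pd_diff[of "f \<alpha>" y "\<lambda>_. f \<alpha> x" l] smooth_on_differentiable[OF f_smooth that] by simp
      then have "flat 1 (pd l (\<lambda>y. f \<alpha> y - f \<alpha> x)) x" for l
        using flat_cong[OF V xV _ pdf_flat[OF that]] by metis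
      then show ?thesis
        by (simp add: numeral_2_eq_2)
    qed
    have "flat 2 (\<lambda>y. L y $ i $ j) x" for i j
      unfolding L
      by (intro flat_add[OF V xV] flat_sum[OF V xV] flat_mult[OF V xV] \<Phi>_flat f_flat
          \<Phi>_smooth smooth_on_sum smooth_on_mult smooth_on_diff smooth_on_const V f_smooth KV)
    then show False
      using not_flat_lincomb[OF xU, of c \<beta>] by (simp add: L_def c_def)
  qed
  ultimately show ?thesis
    using negligible_subset by blast
qed

text \<open>The points of dependence with a common diagonalizing frame are covered by finitely many
  sets, one for each choice of an independent subfamily and an element in its span.\<close>

lemma AE_independent:
  assumes diag: "AE x in lebesgue. x \<in> U \<longrightarrow>
        (\<exists>Q :: real^'n^'n. invertible Q \<and> (\<forall>\<alpha>. diagonal_matrix (Q ** K \<alpha> x ** transpose Q)))"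
  shows "AE x in lebesgue. x \<in> U \<longrightarrow>
            (\<forall>c. (\<Sum>\<alpha>\<in>UNIV. c \<alpha> *\<^sub>R K \<alpha> x) = 0 \<longrightarrow> (\<forall>\<alpha>. c \<alpha> = 0))"
proof -
  define good where "good = (\<lambda>x. \<exists>Q :: real^'n^'n. invertible Q \<and> (\<forall>\<alpha>. diagonal_matrix (Q ** K \<alpha> x ** transpose Q)))"
  define E where "E = (\<lambda>A \<beta>. {x \<in> U. good x \<and> \<beta> \<notin> A
    \<and> (\<forall>c. (\<Sum>\<alpha>\<in>A. c \<alpha> *\<^sub>R K \<alpha> x) = 0 \<longrightarrow> (\<forall>\<alpha>\<in>A. c \<alpha> = 0))
    \<and> (\<exists>c. K \<beta> x = (\<Sum>\<alpha>\<in>A. c \<alpha> *\<^sub>R K \<alpha> x))})"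
  have "negligible (E A \<beta>)" for A \<beta>
  proof (cases "\<beta> \<in> A")
    case True
    then show ?thesis
      by (simp add: E_def)
  next
    case False
    then show ?thesis
      by (rule negligible_dependent_set) (auto simp: E_def good_def)
  qed
  then have "negligible (\<Union>A. \<Union>\<beta>. E A \<beta>)"
    by (intro negligible_finite_UN) auto
  then have "AE x in lebesgue. x \<notin> (\<Union>A. \<Union>\<beta>. E A \<beta>)"
    by (intro AE_not_in) (simp add: negligible_iff_null_sets)
  with diag show ?thesis
  proof eventually_elim
    case (elim x)
    show ?case
    proof (intro impI allI, rule ccontr)
      fix c \<alpha>
      assume *: "x \<in> U" "(\<Sum>\<alpha>\<in>UNIV. c \<alpha> *\<^sub>R K \<alpha> x) = 0" "c \<alpha> \<noteq> 0"
      obtain A \<beta> d where A: "\<beta> \<notin> A" "\<forall>c. (\<Sum>\<alpha>\<in>A. c \<alpha> *\<^sub>R K \<alpha> x) = 0 \<longrightarrow> (\<forall>\<alpha>\<in>A. c \<alpha> = 0)"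
        and d: "K \<beta> x = (\<Sum>\<alpha>\<in>A. d \<alpha> *\<^sub>R K \<alpha> x)"
        using exists_independent_subset_spanning_element[OF *(2,3)] by (elim exE conjE) rule
      have "\<exists>c. K \<beta> x = (\<Sum>\<alpha>\<in>A. c \<alpha> *\<^sub>R K \<alpha> x)"
        using d by (intro exI[of _ d])
      moreover have "good x"
        using elim(1) *(1) by (simp add: good_def)
      ultimately have "x \<in> E A \<beta>"
        using A *(1) by (simp add: E_def)
      then show False
        using elim(2) by auto
    qed
  qed
qed

end

subsection \<open>Simple spectrum\<close>

text \<open>An eigenspace of dimension at least two, tested by a Euclidean orthonormal pair
  unrelated to the metric \<open>g\<close>; the normalization confines the witnesses to compact
  spheres.\<close>

definition repeated_eigenvalue :: "real^'n^'n \<Rightarrow> bool" where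
  "repeated_eigenvalue A \<longleftrightarrow> (\<exists>u w \<mu>. norm u = 1 \<and> norm w = 1 \<and> u \<bullet> w = 0
     \<and> A *v u = \<mu> *\<^sub>R u \<and> A *v w = \<mu> *\<^sub>R w)"

text \<open>The columns of \<open>T\<close> are eigenvectors with eigenvalues
  \<open>\<sigma> i / \<epsilon> i\<close>. Below, \<sigma> and \<epsilon> are the diagonals of a
  tensor and of the inverse metric in a common frame; for an indefinite metric the
  \<open>\<epsilon> i\<close> have both signs.\<close>

locale eigen_frame =
  fixes A T :: "real^'n::finite^'n" and \<sigma> \<epsilon> :: "'n \<Rightarrow> real"
  assumes T: "invertible T"
    and \<epsilon>: "\<And>i. \<epsilon> i \<noteq> 0"
    and eig: "\<And>y \<mu>. A *v (T *v y) = \<mu> *\<^sub>R (T *v y) \<longleftrightarrow> (\<forall>i. \<sigma> i * y $ i = \<mu> * \<epsilon> i * y $ i)"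
begin

lemma frame_coordinates: obtains y where "v = T *v y"
  using T unfolding invertible_def by (metis matrix_vector_mul_assoc matrix_vector_mul_lid)

lemma frame_eq_0: "T *v y = 0 \<longleftrightarrow> y = 0"
  using T unfolding invertible_def
  by (metis matrix_vector_mul_assoc matrix_vector_mul_lid matrix_vector_mult_0_right)

lemma eigenvector_axis: "A *v (T *v axis i 1) = (\<sigma> i / \<epsilon> i) *\<^sub>R (T *v axis i 1)"
  unfolding eig using \<epsilon> by (simp add: axis_def)

lemma eigenvalue_coordinate:
  assumes "A *v (T *v y) = \<mu> *\<^sub>R (T *v y)" "y $ i \<noteq> 0"
  shows "\<mu> = \<sigma> i / \<epsilon> i"
proof -
  have "\<sigma> i * y $ i = \<mu> * \<epsilon> i * y $ i"
    using assms(1) unfolding eig by blast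
  then show ?thesis
    using assms(2) \<epsilon>[of i] by simp
qed

lemma eigenvalues_frame: "eigenvalues A = range (\<lambda>i. \<sigma> i / \<epsilon> i)"
proof (intro set_eqI iffI)
  fix \<mu> assume "\<mu> \<in> eigenvalues A"
  then obtain v where v: "v \<noteq> 0" "A *v v = \<mu> *\<^sub>R v"
    by (auto simp: eigenvalues_def)
  obtain y where y: "v = T *v y"
    by (rule frame_coordinates)
  then obtain i where "y $ i \<noteq> 0"
    using v(1) frame_eq_0 by (auto simp: vec_eq_iff)
  then show "\<mu> \<in> range (\<lambda>i. \<sigma> i / \<epsilon> i)"
    using eigenvalue_coordinate v(2) y by blast
next
  fix \<mu> assume "\<mu> \<in> range (\<lambda>i. \<sigma> i / \<epsilon> i)"
  then obtain i where "\<mu> = \<sigma> i / \<epsilon> i"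
    by blast
  moreover have "T *v axis i 1 \<noteq> 0"
    by (simp add: frame_eq_0 axis_eq_0_iff)
  ultimately show "\<mu> \<in> eigenvalues A"
    unfolding eigenvalues_def using eigenvector_axis by blast
qed

lemma card_eigenvalues_frame:
  "inj (\<lambda>i. \<sigma> i / \<epsilon> i) \<Longrightarrow> card (eigenvalues A) = CARD('n)"
  by (simp add: eigenvalues_frame card_image)

text \<open>If the quotients are distinct, eigenvectors for one eigenvalue have a single nonzero
  coordinate, the same for all of them. They are then proportional, against orthogonality.\<close>

lemma repeated_eigenvalueD:
  assumes "repeated_eigenvalue A"
  shows "\<not> inj (\<lambda>i. \<sigma> i / \<epsilon> i)"
proof
  assume inj: "inj (\<lambda>i. \<sigma> i / \<epsilon> i)"
  obtain u w \<mu> where uw: "norm u = 1" "norm w = 1" "u \<bullet> w = 0"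
      "A *v u = \<mu> *\<^sub>R u" "A *v w = \<mu> *\<^sub>R w"
    using assms unfolding repeated_eigenvalue_def by blast
  obtain y z where yz: "u = T *v y" "w = T *v z"
    using frame_coordinates by metis
  have "y \<noteq> 0" "z \<noteq> 0"
    using uw(1,2) unfolding yz by auto
  then obtain i j where ij: "y $ i \<noteq> 0" "z $ j \<noteq> 0"
    by (auto simp: vec_eq_iff)
  have eq: "k = i" if "y $ k \<noteq> 0 \<or> z $ k \<noteq> 0" for k
    using that ij eigenvalue_coordinate[of y \<mu>] eigenvalue_coordinate[of z \<mu>] uw(4,5) injD[OF inj, of k i]
    unfolding yz by metis
  have "z $ i *\<^sub>R y = y $ i *\<^sub>R z"
  proof -
    have "y $ k = 0 \<and> z $ k = 0" if "k \<noteq> i" for k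
      using eq that by blast
    then have "z $ i * y $ k = y $ i * z $ k" for k
      by (cases "k = i") simp_all
    then show ?thesis
      by (simp add: vec_eq_iff)
  qed
  then have "z $ i *\<^sub>R u = y $ i *\<^sub>R w"
    unfolding yz by (metis matrix_vector_mult_scaleR)
  then have "u \<bullet> (z $ i *\<^sub>R u) = 0"
    using uw(3) by simp
  then have "z $ i = 0"
    using uw(1) by auto
  then show False
    using ij(2) eq by blast
qed

text \<open>Gram-Schmidt inside the eigenspace spanned by two frame vectors.\<close>

lemma repeated_eigenvalueI:
  assumes "\<not> inj (\<lambda>i. \<sigma> i / \<epsilon> i)"
  shows "repeated_eigenvalue A"
proof -
  obtain i j where ij: "i \<noteq> j" "\<sigma> i / \<epsilon> i = \<sigma> j / \<epsilon> j"
    using assms by (auto simp: inj_def)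
  define \<mu> where "\<mu> = \<sigma> i / \<epsilon> i"
  define a b where "a = T *v axis i 1" and "b = T *v axis j 1"
  have ab: "A *v a = \<mu> *\<^sub>R a" "A *v b = \<mu> *\<^sub>R b"
    using eigenvector_axis[of i] eigenvector_axis[of j] ij(2) by (simp_all add: a_def b_def \<mu>_def)
  have indep: "r = 0 \<and> s = 0" if "r *\<^sub>R a + s *\<^sub>R b = 0" for r s
  proof -
    have "T *v (r *\<^sub>R axis i 1 + s *\<^sub>R axis j 1) = 0"
      using that by (simp add: a_def b_def matrix_vector_right_distrib matrix_vector_mult_scaleR)
    then have "r *\<^sub>R axis i 1 + s *\<^sub>R axis j 1 = (0 :: real^'n)"
      by (simp add: frame_eq_0)
    then have "(r *\<^sub>R axis i 1 + s *\<^sub>R axis j 1 :: real^'n) $ k = 0" for k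
      by simp
    from this[of i] this[of j] show ?thesis
      using ij(1) by (simp add: axis_def)
  qed
  define b' where "b' = b - ((a \<bullet> b) / (a \<bullet> a)) *\<^sub>R a"
  have a0: "a \<noteq> 0"
    using indep[of 1 0] by auto
  have b0: "b' \<noteq> 0"
    using indep[of "- ((a \<bullet> b) / (a \<bullet> a))" 1] by (auto simp: b'_def)
  have "a \<bullet> b' = 0"
    using a0 by (simp add: b'_def inner_diff_right)
  moreover have "A *v b' = \<mu> *\<^sub>R b'"
    by (simp add: b'_def matrix_vector_mult_diff_distrib matrix_vector_mult_scaleR ab scaleR_diff_right mult.commute)
  ultimately show ?thesis
    unfolding repeated_eigenvalue_def using a0 b0 ab
    by (intro exI[of _ "(1 / norm a) *\<^sub>R a"] exI[of _ "(1 / norm b') *\<^sub>R b'"] exI[of _ \<mu>])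
      (simp add: matrix_vector_mult_scaleR mult.commute)
qed

end

text \<open>Substituting v = \<open>(G ** transpose Q) *v y\<close> cancels \<open>g\<close> against
  \<open>G\<close>; multiplying by \<open>Q\<close> then leaves two diagonal matrices.\<close>

lemma eigen_frame_pencil:
  fixes S G g Q :: "real^'n::finite^'n"
  assumes "G ** g = mat 1" "invertible Q"
    and "diagonal_matrix (Q ** S ** transpose Q)" "diagonal_matrix (Q ** G ** transpose Q)"
  shows "eigen_frame (S ** g) (G ** transpose Q) (\<lambda>i. (Q ** S ** transpose Q) $ i $ i)
    (\<lambda>i. (Q ** G ** transpose Q) $ i $ i)"
proof
  note [simp del] = transpose_matrix_vector
  have gG: "g ** G = mat 1"
    using assms(1) matrix_left_right_inverse by blast
  have G: "invertible G"
    using assms(1) invertible_right_inverse by blast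
  then show "invertible (G ** transpose Q)"
    using assms(2) by (simp add: invertible_det_nz det_mul)
  have diag: "(D *v y) $ i = D $ i $ i * y $ i" if "diagonal_matrix D" for D :: "real^'n^'n" and y i
  proof -
    have "(D *v y) $ i = (\<Sum>j\<in>UNIV. if j = i then D $ i $ i * y $ i else 0)"
      unfolding matrix_vector_mult_def vec_lambda_beta using that
      by (intro sum.cong) (auto simp: diagonal_matrix_def)
    then show ?thesis by simp
  qed
  show "(Q ** G ** transpose Q) $ i $ i \<noteq> 0" for i
  proof
    assume "(Q ** G ** transpose Q) $ i $ i = 0"
    then have "(Q ** G ** transpose Q) *v axis i 1 = 0"
      by (simp add: vec_eq_iff diag[OF assms(4)] axis_def)
    moreover have "invertible (Q ** G ** transpose Q)"
      using G assms(2) by (simp add: invertible_det_nz det_mul)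
    ultimately have "axis i (1::real) = 0"
      by (metis invertible_def matrix_vector_mul_assoc matrix_vector_mul_lid matrix_vector_mult_0_right)
    then show False
      by (simp add: axis_eq_0_iff)
  qed
  fix y \<mu>
  have Q_inj: "Q *v u = Q *v v \<longleftrightarrow> u = v" for u v
    using assms(2) by (metis invertible_def matrix_vector_mul_assoc matrix_vector_mul_lid)
  have "(S ** g) *v ((G ** transpose Q) *v y) = (S ** (g ** G) ** transpose Q) *v y"
    by (simp only: matrix_vector_mul_assoc matrix_mul_assoc)
  then have "(S ** g) *v ((G ** transpose Q) *v y) = (S ** transpose Q) *v y"
    by (simp add: gG)
  then have "(S ** g) *v ((G ** transpose Q) *v y) = \<mu> *\<^sub>R ((G ** transpose Q) *v y) \<longleftrightarrow>
      Q *v ((S ** transpose Q) *v y) = Q *v (\<mu> *\<^sub>R ((G ** transpose Q) *v y))"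
    by (simp add: Q_inj)
  also have "\<dots> \<longleftrightarrow> (Q ** S ** transpose Q) *v y = \<mu> *\<^sub>R ((Q ** G ** transpose Q) *v y)"
    by (simp add: matrix_vector_mul_assoc matrix_mul_assoc matrix_vector_mult_scaleR)
  also have "\<dots> \<longleftrightarrow> (\<forall>i. (Q ** S ** transpose Q) $ i $ i * y $ i = \<mu> * (Q ** G ** transpose Q) $ i $ i * y $ i)"
    by (simp add: vec_eq_iff diag assms(3,4) mult.assoc)
  finally show "(S ** g) *v ((G ** transpose Q) *v y) = \<mu> *\<^sub>R ((G ** transpose Q) *v y) \<longleftrightarrow>
    (\<forall>i. (Q ** S ** transpose Q) $ i $ i * y $ i = \<mu> * (Q ** G ** transpose Q) $ i $ i * y $ i)" .
qed

text \<open>The eigenvalues are linear in \<open>l\<close>, so each coincidence of two of them is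
  the hyperplane with normal \<open>W i j\<close>. This normal is nonzero, since otherwise two
  columns of \<kappa> would be proportional and the tensors dependent.\<close>

lemma AE_not_repeated_eigenvalue:
  fixes K :: "'n::finite \<Rightarrow> real^'n^'n" and g Q :: "real^'n^'n"
  assumes g: "K a0 ** g = mat 1" and Q: "invertible Q"
    and diag: "\<And>\<alpha>. diagonal_matrix (Q ** K \<alpha> ** transpose Q)"
    and indep: "\<And>c. (\<Sum>\<alpha>\<in>UNIV. c \<alpha> *\<^sub>R K \<alpha>) = 0 \<Longrightarrow> (\<And>\<alpha>. c \<alpha> = 0)"
  shows "AE l in lborel. \<not> repeated_eigenvalue ((\<Sum>\<alpha>\<in>UNIV - {a0}. (l :: real^'n) $ \<alpha> *\<^sub>R K \<alpha>) ** g)"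
proof -
  define \<kappa> where "\<kappa> = (\<lambda>\<alpha> i. (Q ** K \<alpha> ** transpose Q) $ i $ i)"
  \<comment> \<open>The coordinate of \<open>l\<close> at \<open>a0\<close> does not enter the
    combination. At \<open>a0\<close> both quotients are 1, so the entry 0 agrees with the general
    formula.\<close>
  define W where "W = (\<lambda>i j. \<chi> \<alpha>. if \<alpha> = a0 then 0 else \<kappa> \<alpha> i / \<kappa> a0 i - \<kappa> \<alpha> j / \<kappa> a0 j)"
  have frame: "eigen_frame (S ** g) (K a0 ** transpose Q) (\<lambda>i. (Q ** S ** transpose Q) $ i $ i) (\<kappa> a0)"
    if "diagonal_matrix (Q ** S ** transpose Q)" for S
    using eigen_frame_pencil[OF g Q that diag] by (simp add: \<kappa>_def)
  have \<epsilon>: "\<kappa> a0 i \<noteq> 0" for i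
    using eigen_frame.\<epsilon>[OF frame[OF diag]] .
  have W: "W i j \<noteq> 0" if "i \<noteq> j" for i j
  proof
    assume W0: "W i j = 0"
    have *: "\<kappa> \<alpha> i / \<kappa> a0 i = \<kappa> \<alpha> j / \<kappa> a0 j" for \<alpha>
    proof (cases "\<alpha> = a0")
      case False
      have "W i j $ \<alpha> = 0"
        by (simp add: W0)
      then show ?thesis
        using False by (simp add: W_def)
    qed (simp add: \<epsilon>)
    define M :: "real^'n^'n" where "M = (\<chi> \<alpha> k. \<kappa> \<alpha> k)"
    \<comment> \<open>Columns \<open>i\<close> and \<open>j\<close> of \<open>M\<close> agree after
      division by their entries at \<open>a0\<close>, which puts \<open>y\<close> in the
      kernel.\<close>
    define y :: "real^'n" where "y = (1 / \<kappa> a0 i) *\<^sub>R axis i 1 - (1 / \<kappa> a0 j) *\<^sub>R axis j 1"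
    have "(M *v axis k 1) $ \<alpha> = \<kappa> \<alpha> k" for \<alpha> k
      by (simp add: M_def matrix_vector_mult_def axis_def if_distrib[where f = "\<lambda>c. _ * c"] cong: if_cong)
    then have "M *v y = 0"
      using * by (simp add: y_def vec_eq_iff matrix_vector_mult_diff_distrib matrix_vector_mult_scaleR)
    moreover have "y $ i \<noteq> 0"
      using that \<epsilon>[of i] by (simp add: y_def axis_def)
    moreover have "invertible M"
    proof -
      have "c = 0" if c: "transpose M *v c = 0" for c
      proof -
        have "(transpose M *v c) $ i = 0" for i
          using c by simp
        then have s: "(\<Sum>\<alpha>\<in>UNIV. \<kappa> \<alpha> i * c $ \<alpha>) = 0" for i
          by (simp add: matrix_vector_mult_def transpose_def M_def del: transpose_matrix_vector)
        have "(\<Sum>\<alpha>\<in>UNIV. c $ \<alpha> *\<^sub>R (Q ** K \<alpha> ** transpose Q)) $ i $ k = 0" for i k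
        proof (cases "i = k")
          case True
          then show ?thesis
            using s[of k] by (simp add: sum_component \<kappa>_def mult.commute)
        next
          case False
          then show ?thesis
            using diag by (auto simp: sum_component diagonal_matrix_def intro!: sum.neutral)
        qed
        then have "Q ** (\<Sum>\<alpha>\<in>UNIV. c $ \<alpha> *\<^sub>R K \<alpha>) ** transpose Q = 0"
          by (simp add: matrix_congruence_sum[symmetric] vec_eq_iff)
        then have "(\<Sum>\<alpha>\<in>UNIV. c $ \<alpha> *\<^sub>R K \<alpha>) = 0"
          by (rule invertible_congruence_eq_0[OF Q])
        then have "c $ \<alpha> = 0" for \<alpha>
          by (rule indep[of "\<lambda>\<alpha>. c $ \<alpha>"])
        then show ?thesis
          by (simp add: vec_eq_iff)
      qed
      then have "\<exists>B. B ** transpose M = mat 1"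
        unfolding matrix_left_invertible_ker by blast
      then show ?thesis
        using invertible_left_inverse invertible_det_nz by (metis det_transpose)
    qed
    ultimately show False
      unfolding invertible_def
      by (metis matrix_vector_mul_assoc matrix_vector_mul_lid matrix_vector_mult_0_right zero_index)
  qed
  have hyperplane: "\<exists>i j. i \<noteq> j \<and> W i j \<bullet> l = 0"
    if rep: "repeated_eigenvalue ((\<Sum>\<alpha>\<in>UNIV - {a0}. l $ \<alpha> *\<^sub>R K \<alpha>) ** g)" for l :: "real^'n"
  proof -
    define S where "S = (\<Sum>\<alpha>\<in>UNIV - {a0}. l $ \<alpha> *\<^sub>R K \<alpha>)"
    have QS: "Q ** S ** transpose Q = (\<Sum>\<alpha>\<in>UNIV - {a0}. l $ \<alpha> *\<^sub>R (Q ** K \<alpha> ** transpose Q))"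
      by (simp add: S_def matrix_congruence_sum)
    have "diagonal_matrix (Q ** S ** transpose Q)"
      unfolding QS using diag by (auto simp: diagonal_matrix_def sum_component intro!: sum.neutral)
    from eigen_frame.repeated_eigenvalueD[OF frame[OF this]] rep
    obtain i j where ij: "i \<noteq> j"
      "(Q ** S ** transpose Q) $ i $ i / \<kappa> a0 i = (Q ** S ** transpose Q) $ j $ j / \<kappa> a0 j"
      unfolding S_def by (auto simp: inj_def)
    have "(Q ** S ** transpose Q) $ k $ k = (\<Sum>\<alpha>\<in>UNIV - {a0}. l $ \<alpha> * \<kappa> \<alpha> k)" for k
      by (simp add: QS sum_component \<kappa>_def)
    then have "(\<Sum>\<alpha>\<in>UNIV - {a0}. (\<kappa> \<alpha> i / \<kappa> a0 i - \<kappa> \<alpha> j / \<kappa> a0 j) * l $ \<alpha>) = 0"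
      using ij(2) by (simp add: sum_divide_distrib left_diff_distrib right_diff_distrib sum_subtractf mult.commute)
    moreover have "W i j \<bullet> l = (\<Sum>\<alpha>\<in>UNIV - {a0}. (\<kappa> \<alpha> i / \<kappa> a0 i - \<kappa> \<alpha> j / \<kappa> a0 j) * l $ \<alpha>)"
      by (simp add: inner_vec_def W_def sum.remove[of UNIV a0])
    ultimately show ?thesis
      using ij(1) by auto
  qed
  have "negligible (\<Union>i. \<Union>j. if i = j then {} else {l. W i j \<bullet> l = 0})"
    using W by (intro negligible_finite_UN finite) (auto intro: negligible_hyperplane)
  then have "AE l in lebesgue. l \<notin> (\<Union>i. \<Union>j. if i = j then {} else {l. W i j \<bullet> l = 0})"
    by (intro AE_not_in) (simp add: negligible_iff_null_sets)
  then have "AE l in lborel. l \<notin> (\<Union>i. \<Union>j. if i = j then {} else {l. W i j \<bullet> l = 0})"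
    by (simp only: AE_completion_iff)
  then show ?thesis
  proof eventually_elim
    case (elim l)
    then show ?case
      using hyperplane[of l] by auto
  qed
qed

text \<open>An \<open>F\<^sub>\<sigma>\<close> set: the witnesses of a repeated eigenvalue range over a countable union of compact
  sets, and compactness survives projecting them away.\<close>

lemma borel_repeated_eigenvalue:
  fixes K :: "'n::finite \<Rightarrow> real^'n \<Rightarrow> real^'n^'n" and g :: "real^'n \<Rightarrow> real^'n^'n"
  assumes U: "open U" and K: "\<And>\<alpha>. smooth_matrix_field U (K \<alpha>)" and g: "smooth_matrix_field U g"
  shows "{z :: (real^'n) \<times> (real^'n). fst z \<in> U \<and>
     repeated_eigenvalue ((\<Sum>\<alpha>\<in>I. snd z $ \<alpha> *\<^sub>R K \<alpha> (fst z)) ** g (fst z))} \<in> sets borel"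
    (is "?B \<in> _")
proof -
  obtain C :: "nat \<Rightarrow> (real^'n) set" where C: "\<And>n. compact (C n)" "\<And>n. C n \<subseteq> U" "\<Union> (range C) = U"
    using open_Union_compact_subsets[OF U] by metis
  define A where "A = (\<lambda>x (l :: real^'n). (\<Sum>\<alpha>\<in>I. l $ \<alpha> *\<^sub>R K \<alpha> x) ** g x)"
  \<comment> \<open>\<open>C n\<close> exhausts \<open>U\<close>, and \<open>m\<close> bounds both
    \<open>l\<close> and the eigenvalue.\<close>
  define R where "R = (\<lambda>n m. C n \<times> cball (0 :: real^'n) (real m) \<times> sphere (0 :: real^'n) 1
     \<times> sphere (0 :: real^'n) 1 \<times> cball (0 :: real) (real m))"
  define F where "F = (\<lambda>(x, l, u, w, \<mu>). (u \<bullet> w, A x l *v u - \<mu> *\<^sub>R u, A x l *v w - \<mu> *\<^sub>R w))"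
  define P where "P = (\<lambda>n m. (\<lambda>(x, l, u, w, \<mu>). (x, l)) ` {z \<in> R n m. F z = 0})"
  have Kc: "continuous_on (C n) (\<lambda>x. K \<alpha> x $ i $ j)" "continuous_on (C n) (\<lambda>x. g x $ i $ j)" for n \<alpha> i j
    using K g C(2) smooth_on_continuous_on continuous_on_subset unfolding smooth_matrix_field_def by metis+
  have A: "A x l $ i $ j = (\<Sum>k\<in>UNIV. (\<Sum>\<alpha>\<in>I. l $ \<alpha> * K \<alpha> x $ i $ k) * g x $ k $ j)" for x l i j
    by (simp add: A_def matrix_matrix_mult_def sum_component)
  have "compact (P n m)" for n m
  proof -
    have comp: "continuous_on (R n m) (\<lambda>z. K \<alpha> (fst z) $ i $ j)" "continuous_on (R n m) (\<lambda>z. g (fst z) $ i $ j)" for \<alpha> i j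
      by (rule continuous_on_compose2[OF Kc(1)[of n] continuous_on_fst[OF continuous_on_id]],
          force simp: R_def)
        (rule continuous_on_compose2[OF Kc(2)[of n] continuous_on_fst[OF continuous_on_id]],
          force simp: R_def)
    have Ac: "continuous_on (R n m) (\<lambda>z. A (fst z) (fst (snd z)) $ i $ j)" for i j
      unfolding A by (intro continuous_intros comp)
    have "continuous_on (R n m) F"
      unfolding F_def case_prod_unfold matrix_vector_mult_def
      by (intro continuous_intros Ac)
    moreover have R: "compact (R n m)"
      unfolding R_def by (intro compact_Times compact_cball compact_sphere C)
    ultimately have "closed {z \<in> R n m. F z = 0}"
      by (intro continuous_closed_preimage_constant compact_imp_closed)
    then have "compact {z \<in> R n m. F z = 0}"
      using compact_Int_closed[OF R] by (metis (no_types, lifting) Int_absorb1 mem_Collect_eq subsetI)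
    then show ?thesis
      unfolding P_def case_prod_unfold
      by (intro compact_continuous_image continuous_intros)
  qed
  then have "(\<Union>n. \<Union>m. P n m) \<in> sets borel"
    by (intro sets.countable_UN'') (auto intro: borel_compact)
  moreover have "?B = (\<Union>n. \<Union>m. P n m)"
  proof (intro set_eqI iffI)
    fix z assume z: "z \<in> ?B"
    obtain x l where xl: "z = (x, l)"
      by (cases z)
    obtain u w \<mu> where uw: "norm u = 1" "norm w = 1" "u \<bullet> w = 0"
      "A x l *v u = \<mu> *\<^sub>R u" "A x l *v w = \<mu> *\<^sub>R w"
      using z unfolding repeated_eigenvalue_def A_def xl by auto
    obtain n where n: "x \<in> C n"
      using z C(3) unfolding xl by auto
    obtain m where "max (norm l) \<bar>\<mu>\<bar> \<le> real m"
      using real_arch_simple by blast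
    then have "(x, l, u, w, \<mu>) \<in> {z \<in> R n m. F z = 0}"
      using uw n by (simp add: R_def F_def zero_prod_def)
    then have "z \<in> P n m"
      unfolding P_def xl by (rule image_eqI[rotated]) simp
    then show "z \<in> (\<Union>n. \<Union>m. P n m)"
      by blast
  next
    fix z assume "z \<in> (\<Union>n. \<Union>m. P n m)"
    then obtain n m x l u w \<mu> where *: "(x, l, u, w, \<mu>) \<in> R n m" "F (x, l, u, w, \<mu>) = 0" "z = (x, l)"
      unfolding P_def by auto
    then have "x \<in> U"
      using C(2)[of n] by (auto simp: R_def)
    moreover have "repeated_eigenvalue (A x l)"
      unfolding repeated_eigenvalue_def using *(1,2)
      by (intro exI[of _ u] exI[of _ w] exI[of _ \<mu>]) (simp add: R_def F_def zero_prod_def)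
    ultimately show "z \<in> ?B"
      by (simp add: A_def *(3))
  qed
  ultimately show ?thesis
    by simp
qed

theorem theorem1:
  fixes U :: "(real^'n) set"
    and g :: "real^'n \<Rightarrow> real^'n^'n"
    and K :: "'n \<Rightarrow> real^'n \<Rightarrow> real^'n^'n"
    and a0 :: 'n
  assumes U: "open U" "connected U" "U \<noteq> {}"
    and g_smooth: "smooth_matrix_field U g"
    and g_sym: "\<And>x. x \<in> U \<Longrightarrow> symmetric_matrix (g x)"
    and g_nondeg: "\<And>x. x \<in> U \<Longrightarrow> invertible (g x)"
    and K_smooth: "\<And>\<alpha>. smooth_matrix_field U (K \<alpha>)"
    and K_sym: "\<And>\<alpha> x. x \<in> U \<Longrightarrow> symmetric_matrix (K \<alpha> x)"
    and K_a0: "\<And>x. x \<in> U \<Longrightarrow> K a0 x = matrix_inv (g x)"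
    and integrals: "\<And>\<alpha> x p. x \<in> U \<Longrightarrow>
        poisson (\<lambda>z. (1/2) * quad_fun (\<lambda>y. matrix_inv (g y)) z) (quad_fun (K \<alpha>)) (x, p) = 0"
    and diag: "AE x in lebesgue. x \<in> U \<longrightarrow>
        (\<exists>Q :: real^'n^'n. invertible Q \<and>
           (\<forall>\<alpha>. diagonal_matrix (Q ** K \<alpha> x ** transpose Q)))"
    and indep_diff: "\<exists>x\<in>U. \<exists>p. \<exists>D :: 'n \<Rightarrow> (real^'n) \<times> (real^'n) \<Rightarrow> real.
        (\<forall>\<alpha>. (quad_fun (K \<alpha>) has_derivative D \<alpha>) (at (x, p))) \<and>
        (\<forall>c :: 'n \<Rightarrow> real. (\<forall>v. (\<Sum>\<alpha>\<in>UNIV. c \<alpha> * D \<alpha> v) = 0) \<longrightarrow> (\<forall>\<alpha>. c \<alpha> = 0))"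
  shows "(AE x in lebesgue. x \<in> U \<longrightarrow>
            (\<forall>c :: 'n \<Rightarrow> real. (\<Sum>\<alpha>\<in>UNIV. c \<alpha> *\<^sub>R K \<alpha> x) = 0 \<longrightarrow> (\<forall>\<alpha>. c \<alpha> = 0)))
       \<and> (AE l in lborel. AE x in lebesgue. x \<in> U \<longrightarrow>
            card (eigenvalues ((\<Sum>\<alpha>\<in>UNIV - {a0}. (l :: real^'n) $ \<alpha> *\<^sub>R K \<alpha> x) ** g x))
              = CARD('n))"
proof -
  have inv: "K a0 x ** g x = mat 1" if "x \<in> U" for x
    using someI_ex[OF g_nondeg[OF that, unfolded invertible_def]] K_a0[OF that]
    by (simp add: matrix_inv_def)
  have killing: "killing_form (K a0) (K \<alpha>) x p = 0" if x: "x \<in> U" for \<alpha> x p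
  proof -
    \<comment> \<open>\<open>K a0\<close> is the inverse metric on \<open>U\<close> only; the
      brackets agree because derivatives are local.\<close>
    have "open (U \<times> (UNIV :: (real^'n) set))" "(x, p) \<in> U \<times> UNIV"
      using U(1) x by (auto intro: open_Times)
    then have "frechet_derivative (\<lambda>z. (1/2) * quad_fun (\<lambda>y. matrix_inv (g y)) z) (at (x, p)) =
        frechet_derivative (\<lambda>z. (1/2) * quad_fun (K a0) z) (at (x, p))"
      by (rule frechet_derivative_cong_open) (auto simp: quad_fun_def K_a0)
    then have "poisson (\<lambda>z. (1/2) * quad_fun (K a0) z) (quad_fun (K \<alpha>)) (x, p) = 0"
      using integrals[OF x, of \<alpha> p] by (simp add: poisson_def)
    then show ?thesis
      using poisson_quad_fun[OF K_smooth K_smooth x K_sym[OF x] K_sym[OF x]] by simp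
  qed
  obtain x1 p1 D where x1: "x1 \<in> U"
    and D: "\<And>\<alpha>. (quad_fun (K \<alpha>) has_derivative D \<alpha>) (at (x1, p1))"
      "\<And>c :: 'n \<Rightarrow> real. \<forall>v. (\<Sum>\<alpha>\<in>UNIV. c \<alpha> * D \<alpha> v) = 0 \<Longrightarrow> \<forall>\<alpha>. c \<alpha> = 0"
    using indep_diff by metis
  interpret killing_family U "K a0" g K
  proof
    fix c \<alpha> assume c: "\<And>x. x \<in> U \<Longrightarrow> (\<Sum>\<alpha>\<in>UNIV. c \<alpha> *\<^sub>R K \<alpha> x) = 0"
    have zero: "(\<Sum>\<alpha>\<in>UNIV. c \<alpha> * quad_fun (K \<alpha>) z) = 0" if "z \<in> U \<times> UNIV" for z
    proof -
      have "(\<Sum>\<alpha>\<in>UNIV. c \<alpha> * quad_fun (K \<alpha>) z) = snd z \<bullet> ((\<Sum>\<alpha>\<in>UNIV. c \<alpha> *\<^sub>R K \<alpha> (fst z)) *v snd z)"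
        by (simp add: quad_fun_def matrix_vector_mult_sum_scaleR inner_sum_right)
      then show ?thesis
        using c that by auto
    qed
    \<comment> \<open>A relation between the tensors on \<open>U\<close> annihilates the combined
      integral near \<open>(x1, p1)\<close>, hence also the combination of differentials
      there.\<close>
    have "((\<lambda>z. \<Sum>\<alpha>\<in>UNIV. c \<alpha> * quad_fun (K \<alpha>) z) has_derivative (\<lambda>v. \<Sum>\<alpha>\<in>UNIV. c \<alpha> * D \<alpha> v)) (at (x1, p1))"
      by (intro has_derivative_sum has_derivative_mult_right D(1))
    moreover have "open (U \<times> (UNIV :: (real^'n) set))" "(x1, p1) \<in> U \<times> UNIV"
      using U(1) x1 by (auto intro: open_Times)
    ultimately have "((\<lambda>z. 0) has_derivative (\<lambda>v. \<Sum>\<alpha>\<in>UNIV. c \<alpha> * D \<alpha> v)) (at (x1, p1))"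
      using zero by (simp cong: has_derivative_cong_open)
    then have "(\<lambda>v. \<Sum>\<alpha>\<in>UNIV. c \<alpha> * D \<alpha> v) = (\<lambda>v. 0)"
      using has_derivative_const has_derivative_unique by blast
    then show "c \<alpha> = 0"
      using D(2)[of c] by metis
  qed (use U g_smooth K_smooth inv g_sym K_sym killing in auto)
  have indep: "AE x in lebesgue. x \<in> U \<longrightarrow>
            (\<forall>c :: 'n \<Rightarrow> real. (\<Sum>\<alpha>\<in>UNIV. c \<alpha> *\<^sub>R K \<alpha> x) = 0 \<longrightarrow> (\<forall>\<alpha>. c \<alpha> = 0))"
    using diag by (rule AE_independent)
  \<comment> \<open>\<open>l\<close> ranges over all of R^n with its coordinate at \<open>a0\<close>
    as a dummy, so that the parameters form a vector over the same index type.\<close>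
  let ?A = "\<lambda>x (l :: real^'n). (\<Sum>\<alpha>\<in>UNIV - {a0}. l $ \<alpha> *\<^sub>R K \<alpha> x) ** g x"
  have "AE x in lebesgue. AE l in lborel. \<not> (x \<in> U \<and> repeated_eigenvalue (?A x l))"
    using diag indep
  proof eventually_elim
    case (elim x)
    show ?case
    proof (cases "x \<in> U")
      case True
      then obtain Q :: "real^'n^'n" where "invertible Q" "\<And>\<alpha>. diagonal_matrix (Q ** K \<alpha> x ** transpose Q)"
        using elim(1) by blast
      then have "AE l in lborel. \<not> repeated_eigenvalue (?A x l)"
        using elim(2) True by (intro AE_not_repeated_eigenvalue[where K = "\<lambda>\<alpha>. K \<alpha> x", OF inv[OF True]]) blast+
      then show ?thesis
        by eventually_elim simp
    qed simp
  qed
  \<comment> \<open>The exchange of quantifiers is done for Borel measures; passing to the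
    completion and back preserves statements that hold almost everywhere.\<close>
  then have "AE x in lborel. AE l in lborel. \<not> (x \<in> U \<and> repeated_eigenvalue (?A x l))"
    by (simp only: AE_completion_iff)
  moreover have "{z \<in> space (lborel \<Otimes>\<^sub>M lborel). \<not> (fst z \<in> U \<and> repeated_eigenvalue (?A (fst z) (snd z)))}
      \<in> sets (lborel \<Otimes>\<^sub>M lborel)"
  proof -
    have "- {z. fst z \<in> U \<and> repeated_eigenvalue (?A (fst z) (snd z))} \<in> sets borel"
      using borel_repeated_eigenvalue[OF U(1) K_smooth g_smooth] by (rule borel_comp)
    then show ?thesis
      unfolding lborel_prod by (simp add: Compl_eq)
  qed
  ultimately have "AE l in lborel. AE x in lborel. \<not> (x \<in> U \<and> repeated_eigenvalue (?A x l))"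
    by (subst (asm) lborel_pair.AE_commute)
  then have "AE l in lborel. AE x in lebesgue. x \<in> U \<longrightarrow> card (eigenvalues (?A x l)) = CARD('n)"
  proof eventually_elim
    case (elim l)
    then have "AE x in lebesgue. \<not> (x \<in> U \<and> repeated_eigenvalue (?A x l))"
      by (rule AE_completion)
    \<comment> \<open>The diagonalizing frame is used again: without it a simple spectrum would not
      give n real eigenvalues.\<close>
    with diag show ?case
    proof eventually_elim
      case (elim x)
      show ?case
      proof
        assume x: "x \<in> U"
        then obtain Q :: "real^'n^'n" where Q: "invertible Q" "\<And>\<alpha>. diagonal_matrix (Q ** K \<alpha> x ** transpose Q)"
          using elim(1) by blast
        have "diagonal_matrix (Q ** (\<Sum>\<alpha>\<in>UNIV - {a0}. l $ \<alpha> *\<^sub>R K \<alpha> x) ** transpose Q)"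
          unfolding matrix_congruence_sum[symmetric] using Q(2)
          by (auto simp: diagonal_matrix_def sum_component intro!: sum.neutral)
        then interpret eigen_frame "?A x l" "K a0 x ** transpose Q"
            "\<lambda>i. (Q ** (\<Sum>\<alpha>\<in>UNIV - {a0}. l $ \<alpha> *\<^sub>R K \<alpha> x) ** transpose Q) $ i $ i"
            "\<lambda>i. (Q ** K a0 x ** transpose Q) $ i $ i"
          using inv[OF x] Q by (intro eigen_frame_pencil)
        show "card (eigenvalues (?A x l)) = CARD('n)"
          using card_eigenvalues_frame repeated_eigenvalueI elim(2) x by blast
      qed
    qed
  qed
  with indep show ?thesis
    by (rule conjI)
qed

end
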